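(* Let $n\ge 1$, let $G\subset PU(1,n)$ be a discrete subgroup, acting on $\mathbb{P}^n_{\mathbb{C}}$, and let $Eq(G)\subset \mathbb{P}^n_{\mathbb{C}}$ be its equicontinuity region. Then: (a) $\mathbb{P}^n_{\mathbb{C}}\setminus Eq(G)=\bigcup_{p\in\Lambda_{CG}(G)}\mathcal{H}_p$, i.e. the complement of $Eq(G)$ is the union of all complex projective hyperplanes tangent to $\partial\mathbb{H}^n_{\mathbb{C}}$ at points of the Chen-Greenberg limit set $\Lambda_{CG}(G)$; (b) $G$ acts discontinuously on $Eq(G)$; (c) for every compact set $K\subset Eq(G)$, the set of accumulation points of the $G$-orbit $\{g(K)\}_{g\in G}$ of $K$ is contained in $\Lambda_{CG}(G)$.
   Context: $\mathbb{P}^n_{\mathbb{C}}=(\mathbb{C}^{n+1}\setminus\{0\})/\mathbb{C}^*$, with quotient map $[\ ]_n$; a hyperplane is a complex projective subspace of dimension $n-1$. $PSL(n+1,\mathbb{C})$ is the group of projective automorphisms of $\mathbb{P}^n_{\mathbb{C}}$. Equip $\mathbb{C}^{n+1}$ with the Hermitian form $\langle u,v\rangle=-u_0\overline{v_0}+\sum_{j=1}^n u_j\overline{v_j}$. $U(1,n)\subset GL(n+1,\mathbb{C})$ is the group preserving this form and $PU(1,n)\subset PSL(n+1,\mathbb{C})$ is its projectivization. $\mathbb{H}^n_{\mathbb{C}}=\{[u]_n:\langle u,u\rangle<0\}$ is complex hyperbolic space (a ball with the Bergman metric, on which $PU(1,n)$ acts by holomorphic isometries), $\partial\mathbb{H}^n_{\mathbb{C}}=\{[u]_n: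 u\neq 0,\ \langle u,u\rangle=0\}$ and $\overline{\mathbb{H}}^n_{\mathbb{C}}=\mathbb{H}^n_{\mathbb{C}}\cup\partial\mathbb{H}^n_{\mathbb{C}}$. The Chen-Greenberg limit set $\Lambda_{CG}(G)$ is the set of accumulation points in $\overline{\mathbb{H}}^n_{\mathbb{C}}$ of $G$-orbits of points of $\mathbb{H}^n_{\mathbb{C}}$; it is contained in $\partial\mathbb{H}^n_{\mathbb{C}}$. For $p\in\partial\mathbb{H}^n_{\mathbb{C}}$, $\mathcal{H}_p$ denotes the (unique) complex projective hyperplane tangent to $\partial\mathbb{H}^n_{\mathbb{C}}$ at $p$; if $p=[u]_n$, it is $\{[v]_n:\langle v,u\rangle=0\}$. The equicontinuity region $Eq(G)$ is the set of points $z\in\mathbb{P}^n_{\mathbb{C}}$ having an open neighborhood $U$ such that $G|_U$ is a normal family, meaning that every sequence of distinct elements of it has a subsequence which converges uniformly on compact subsets of $U$ (as maps $U\to\mathbb{P}^n_{\mathbb{C}}$). $G$ acts discontinuously on a $G$-invariant open set $\Omega$ if each point of $\Omega$ has a neighborhood $U$ such that $g(U)\cap U\neq\emptyset$ for only finitely many $g\in G$. A point $z$ is an accumulation point (cluster point) of the orbit of a set $K$ if every neighborhood of $z$ meets $g(K)$ for infinitely many $g\in G$. *)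

theory Defs
  imports "HOL-Analysis.Analysis" "HOL-Algebra.Group"
begin

text \<open>
  For a finite index type \<open>'a\<close>, \<open>'a cproj\<close> is the projectivization of \<open>complex ^ 'a\<close>, and
  \<open>proj u\<close> is the class \<open>[u]\<close>. The value \<open>proj 0\<close> is meaningless.
\<close>

definition proj_rel :: "complex ^ 'a \<Rightarrow> complex ^ 'a \<Rightarrow> bool" where
  "proj_rel u v \<longleftrightarrow> u \<noteq> 0 \<and> v \<noteq> 0 \<and> (\<exists>c. c \<noteq> 0 \<and> v = c *s u)"

lemma part_equivp_proj_rel: "part_equivp (proj_rel :: complex ^ 'a \<Rightarrow> _)"
proof (rule part_equivpI)
  show "\<exists>x. proj_rel x (x :: complex ^ 'a)"
    unfolding proj_rel_def by (intro exI[of _ 1]) (auto intro!: exI[of _ 1])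
  show "symp (proj_rel :: complex ^ 'a \<Rightarrow> _)"
  proof (rule sympI)
    fix u v :: "complex ^ 'a" assume "proj_rel u v"
    then obtain c where "u \<noteq> 0" "v \<noteq> 0" "c \<noteq> 0" "v = c *s u"
      unfolding proj_rel_def by blast
    then show "proj_rel v u"
      unfolding proj_rel_def by (auto simp: vector_smult_assoc intro!: exI[of _ "inverse c"])
  qed
  show "transp (proj_rel :: complex ^ 'a \<Rightarrow> _)"
    unfolding proj_rel_def
    by (rule transpI) (metis mult_eq_0_iff vector_smult_assoc)
qed

quotient_type 'a cproj = "complex ^ ('a :: finite)" / partial: proj_rel
  morphisms rep_cproj proj
  by (rule part_equivp_proj_rel)

lemma proj_eq_iff:
  assumes "u \<noteq> 0" "v \<noteq> 0"
  shows "proj u = proj v \<longleftrightarrow> (\<exists>c. c \<noteq> 0 \<and> v = c *s u)"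
proof -
  have r: "proj_rel w w" if "w \<noteq> 0" for w :: "complex ^ 'a"
    unfolding proj_rel_def using that by (auto intro!: exI[of _ 1])
  have "proj u = proj v \<longleftrightarrow> proj_rel u v"
    using Quotient3_rel[OF Quotient3_cproj] r assms by blast
  then show ?thesis using assms by (simp add: proj_rel_def)
qed

lemma rep_cproj_nonzero: "rep_cproj p \<noteq> 0"
  using Quotient3_rep_reflp[OF Quotient3_cproj, of p] by (simp add: proj_rel_def)

lemma proj_rep_cproj [simp]: "proj (rep_cproj p) = p"
  by (rule Quotient3_abs_rep[OF Quotient3_cproj])

text \<open>
  The topology is the quotient topology. The metric needed for uniform convergence is the
  Frobenius distance between the orthogonal projectors onto the two lines, which is
  \<open>sqrt 2\<close> times the sine of the Fubini-Study angle; since projective space is compact, every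
  metric inducing the topology gives the same uniform convergence.
\<close>

definition line_projector :: "complex ^ 'a \<Rightarrow> complex ^ 'a ^ 'a" where
  "line_projector u = (\<chi> i j. u $ i * cnj (u $ j) / complex_of_real ((norm u)\<^sup>2))"

lemma norm_square_complex_vec:
  "complex_of_real ((norm u)\<^sup>2) = (\<Sum>j\<in>UNIV. u $ j * cnj (u $ j))"
proof -
  have "(norm u)\<^sup>2 = (\<Sum>j\<in>UNIV. (cmod (u $ j))\<^sup>2)"
    by (simp add: norm_vec_def L2_set_def sum_nonneg)
  then show ?thesis
    by (simp add: complex_norm_square[symmetric])
qed

lemma norm_smult_complex_vec: "norm (c *s u) = cmod c * norm (u :: complex ^ 'a)"
  by (simp add: norm_vec_def norm_mult L2_set_right_distrib)

lemma line_projector_smult: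
  assumes "c \<noteq> 0"
  shows "line_projector (c *s u) = line_projector u"
proof -
  have "complex_of_real ((norm (c *s u))\<^sup>2) = (c * cnj c) * complex_of_real ((norm u)\<^sup>2)"
    by (simp add: norm_smult_complex_vec power_mult_distrib complex_norm_square[symmetric])
  then show ?thesis
    using assms by (simp add: line_projector_def vec_eq_iff)
qed

lemma line_projector_mult:
  "line_projector u *v v
    = ((\<Sum>j\<in>UNIV. cnj (u $ j) * v $ j) / complex_of_real ((norm u)\<^sup>2)) *s u"
  by (simp add: vec_eq_iff matrix_vector_mult_def line_projector_def sum_divide_distrib
      sum_distrib_left sum_distrib_right mult_ac)

lemma line_projector_self:
  assumes "u \<noteq> 0"
  shows "line_projector u *v u = u"
proof -
  have "(\<Sum>j\<in>UNIV. cnj (u $ j) * u $ j) = complex_of_real ((norm u)\<^sup>2)"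
    unfolding norm_square_complex_vec by (simp add: mult.commute)
  then show ?thesis using assms by (simp add: line_projector_mult)
qed

lemma line_projector_inject:
  assumes "u \<noteq> 0" "v \<noteq> 0" "line_projector u = line_projector v"
  shows "proj u = proj v"
proof -
  obtain c where "u = c *s v"
    using line_projector_self[OF assms(1)] line_projector_mult[of v u] assms(3) by metis
  then have "proj v = proj u"
    using assms by (subst proj_eq_iff) auto
  then show ?thesis by simp
qed

lift_definition cproj_projector :: "('a :: finite) cproj \<Rightarrow> complex ^ 'a ^ 'a"
  is line_projector
  by (auto simp: proj_rel_def line_projector_smult)

lemma cproj_projector_proj:
  assumes "u \<noteq> 0"
  shows "cproj_projector (proj u) = line_projector u"
proof -
  have "proj_rel u u" using assms by (auto simp: proj_rel_def intro!: exI[of _ 1])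
  then show ?thesis by (rule cproj_projector.abs_eq)
qed

lemma continuous_on_line_projector: "continuous_on (- {0}) line_projector"
  unfolding line_projector_def by (intro continuous_intros) auto

instantiation cproj :: (finite) metric_space
begin

definition open_cproj :: "'a cproj set \<Rightarrow> bool" where
  "open_cproj S \<longleftrightarrow> open {u. u \<noteq> 0 \<and> proj u \<in> S}"

definition dist_cproj :: "'a cproj \<Rightarrow> 'a cproj \<Rightarrow> real" where
  "dist_cproj p q = dist (cproj_projector p) (cproj_projector q)"

definition uniformity_cproj :: "('a cproj \<times> 'a cproj) filter" where
  "uniformity_cproj = (INF e\<in>{0<..}. principal {(p, q). dist p q < e})"

lemma open_cproj_iff_dist:
  "open S \<longleftrightarrow> (\<forall>p\<in>S. \<exists>e>0. \<forall>q. dist q p < e \<longrightarrow> q \<in> (S :: 'a cproj set))"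
proof
  assume S: "open S"
  show "\<forall>p\<in>S. \<exists>e>0. \<forall>q. dist q p < e \<longrightarrow> q \<in> S"
  proof
    fix p assume "p \<in> S"
    define u where "u = rep_cproj p"
    have u: "u \<noteq> 0" "proj u = p" by (simp_all add: u_def rep_cproj_nonzero)
    define T where "T = {u. u \<noteq> 0 \<and> proj u \<in> S}"
    have T: "open T" "u \<in> T" using S u \<open>p \<in> S\<close> by (auto simp: T_def open_cproj_def)
    have "linear (\<lambda>A :: complex ^ 'a ^ 'a. A *v u)"
      by (rule linearI)
        (simp_all add: vec_eq_iff matrix_vector_mult_def scaleR_right.sum sum.distrib algebra_simps)
    then have "isCont (\<lambda>A :: complex ^ 'a ^ 'a. A *v u) (line_projector u)"
      by (intro linear_continuous_at) (simp add: linear_conv_bounded_linear)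
    then have "((\<lambda>A. A *v u) \<longlongrightarrow> u) (at (line_projector u))"
      using line_projector_self[OF u(1)] by (simp add: isCont_def)
    then have "\<forall>\<^sub>F A in at (line_projector u). A *v u \<in> T"
      using T by (rule topological_tendstoD)
    then obtain e where e: "e > 0"
      "\<And>A. A \<noteq> line_projector u \<Longrightarrow> dist A (line_projector u) < e \<Longrightarrow> A *v u \<in> T"
      unfolding eventually_at by auto
    have "q \<in> S" if "dist q p < e" for q
    proof -
      define v where "v = rep_cproj q"
      have v: "v \<noteq> 0" "proj v = q" by (simp_all add: v_def rep_cproj_nonzero)
      have "dist (line_projector v) (line_projector u) < e"
        using that u v by (metis dist_cproj_def cproj_projector_proj)
      then have w: "line_projector v *v u \<in> T"
        using e(2) T(2) line_projector_self[OF u(1)] by metis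
      then obtain c where "line_projector v *v u = c *s v" "c \<noteq> 0"
        unfolding line_projector_mult T_def by (auto simp del: divide_eq_0_iff)
      then have "proj (line_projector v *v u) = q"
        using v w proj_eq_iff[of v "line_projector v *v u"] by (auto simp: T_def)
      then show "q \<in> S" using w by (simp add: T_def)
    qed
    then show "\<exists>e>0. \<forall>q. dist q p < e \<longrightarrow> q \<in> S" using e(1) by blast
  qed
next
  assume R: "\<forall>p\<in>S. \<exists>e>0. \<forall>q. dist q p < e \<longrightarrow> q \<in> S"
  show "open S"
    unfolding open_cproj_def
  proof (subst open_subopen, intro ballI)
    fix u assume "u \<in> {u. u \<noteq> 0 \<and> proj u \<in> S}"
    then have u: "u \<noteq> 0" "proj u \<in> S" by auto
    then obtain e where e: "e > 0" "\<And>q. dist q (proj u) < e \<Longrightarrow> q \<in> S"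
      using R by blast
    let ?T = "- {0} \<inter> line_projector -` ball (line_projector u) e"
    have "open ?T"
      by (rule continuous_open_preimage[OF continuous_on_line_projector]) auto
    moreover have "?T \<subseteq> {u. u \<noteq> 0 \<and> proj u \<in> S}"
      using e(2) u by (auto simp: dist_cproj_def cproj_projector_proj dist_commute)
    ultimately show "\<exists>T. open T \<and> u \<in> T \<and> T \<subseteq> {u. u \<noteq> 0 \<and> proj u \<in> S}"
      using u e(1) by (intro exI[of _ ?T]) auto
  qed
qed

instance
proof
  fix p q r :: "'a cproj"
  show "dist p q = 0 \<longleftrightarrow> p = q"
    using line_projector_inject[of "rep_cproj p" "rep_cproj q"]
    by (metis cproj_projector_proj dist_cproj_def dist_eq_0_iff proj_rep_cproj rep_cproj_nonzero)
  show "dist p q \<le> dist p r + dist q r"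
    unfolding dist_cproj_def by (rule dist_triangle2)
next
  fix U :: "'a cproj set"
  have "(\<forall>\<^sub>F (x', y) in uniformity. x' = x \<longrightarrow> y \<in> U)
      \<longleftrightarrow> (\<exists>e>0. \<forall>q. dist q x < e \<longrightarrow> q \<in> U)" for x
  proof -
    have "(\<forall>\<^sub>F z in uniformity. P z) \<longleftrightarrow> (\<exists>e>0. \<forall>p q :: 'a cproj. dist p q < e \<longrightarrow> P (p, q))" for P
      unfolding uniformity_cproj_def
    proof (subst eventually_INF_base)
      show "\<exists>c\<in>{0<..}. principal {(p, q :: 'a cproj). dist p q < c}
          \<le> inf (principal {(p, q). dist p q < a}) (principal {(p, q). dist p q < b})"
        if "a \<in> {0<..}" "b \<in> {0<..}" for a b :: real
        using that by (intro bexI[of _ "min a b"]) auto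
    qed (auto simp: eventually_principal)
    then show ?thesis
      by (simp add: dist_cproj_def dist_commute)
  qed
  then show "open U \<longleftrightarrow> (\<forall>x\<in>U. \<forall>\<^sub>F (x', y) in uniformity. x' = x \<longrightarrow> y \<in> U)"
    by (simp add: open_cproj_iff_dist)
qed (simp add: uniformity_cproj_def)

end

definition proj_act :: "complex ^ 'a ^ 'a \<Rightarrow> 'a cproj \<Rightarrow> ('a :: finite) cproj" where
  "proj_act A p = proj (A *v rep_cproj p)"

lemma matrix_vector_mult_smult: "A *v (c *s u) = c *s (A *v (u :: complex ^ 'a))"
  by (simp add: vec_eq_iff matrix_vector_mult_def sum_distrib_left mult_ac)

lemma invertible_mult_nonzero:
  assumes "invertible A" "u \<noteq> 0"
  shows "A *v u \<noteq> (0 :: complex ^ 'a)"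
  using assms by (metis invertible_def matrix_vector_mul_assoc matrix_vector_mul_lid
      matrix_vector_mult_0_right)

lemma proj_act_proj:
  assumes "invertible A" "u \<noteq> 0"
  shows "proj_act A (proj u) = proj (A *v u)"
proof -
  obtain c where "c \<noteq> 0" "rep_cproj (proj u) = c *s u"
    using proj_eq_iff[OF assms(2) rep_cproj_nonzero[of "proj u"]] by auto
  then show ?thesis
    using assms invertible_mult_nonzero[OF assms] rep_cproj_nonzero[of "proj u"]
    unfolding proj_act_def
    by (metis invertible_mult_nonzero matrix_vector_mult_smult proj_eq_iff)
qed

lemma proj_act_mult:
  assumes "invertible A" "invertible B"
  shows "proj_act (A ** B) = proj_act A \<circ> proj_act B"
proof
  fix p
  show "proj_act (A ** B) p = (proj_act A \<circ> proj_act B) p"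
    using proj_act_proj[OF assms(1) invertible_mult_nonzero[OF assms(2) rep_cproj_nonzero[of p]]]
    by (simp add: proj_act_def matrix_vector_mul_assoc)
qed

lemma proj_act_one: "proj_act (mat 1) = id"
  by (auto simp: proj_act_def)

text \<open>
  The index type \<open>'n option\<close> has \<open>n + 1\<close> elements for \<open>n = CARD('n) \<ge> 1\<close>: \<open>None\<close> is the index \<open>0\<close>
  and the values \<open>Some j\<close> are the indices \<open>1, \<dots>, n\<close>. So \<open>'n option cproj\<close> is \<open>n\<close>-dimensional.
\<close>

definition herm :: "complex ^ ('n :: finite) option \<Rightarrow> complex ^ 'n option \<Rightarrow> complex" where
  "herm u v = - (u $ None * cnj (v $ None)) + (\<Sum>j\<in>UNIV. u $ Some j * cnj (v $ Some j))"

definition U1 :: "(complex ^ ('n :: finite) option ^ 'n option) set" where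
  "U1 = {A. invertible A \<and> (\<forall>u v. herm (A *v u) (A *v v) = herm u v)}"

definition PU1 :: "(('n :: finite) option cproj \<Rightarrow> 'n option cproj) monoid" where
  "PU1 = \<lparr>carrier = proj_act ` U1, mult = (\<circ>), one = id\<rparr>"

lemma U1_one: "mat 1 \<in> U1"
  by (auto simp: U1_def invertible_def intro!: exI[of _ "mat 1"])

lemma U1_mult:
  assumes "A \<in> U1" "B \<in> U1"
  shows "A ** B \<in> U1"
  using assms by (auto simp: U1_def invertible_mult matrix_vector_mul_assoc[symmetric])

lemma U1_inverse:
  assumes "A \<in> U1"
  shows "\<exists>B\<in>U1. B ** A = mat 1"
proof -
  obtain B where B: "A ** B = mat 1" "B ** A = mat 1"
    using assms by (auto simp: U1_def invertible_def)
  have "herm (B *v u) (B *v v) = herm u v" for u v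
    using assms B(1) by (metis (mono_tags, lifting) U1_def matrix_vector_mul_assoc
        matrix_vector_mul_lid mem_Collect_eq)
  then have "B \<in> U1" using B by (auto simp: U1_def invertible_def)
  then show ?thesis using B by blast
qed

lemma group_PU1: "group (PU1 :: ('n :: finite option cproj \<Rightarrow> 'n option cproj) monoid)"
proof (rule groupI)
  have inv: "invertible A" if "A \<in> U1" for A :: "complex ^ 'n option ^ 'n option"
    using that by (simp add: U1_def)
  show "\<one>\<^bsub>PU1\<^esub> \<in> carrier (PU1 :: ('n option cproj \<Rightarrow> _) monoid)"
    using imageI[OF U1_one, of proj_act] by (simp add: PU1_def proj_act_one)
  show "f \<otimes>\<^bsub>PU1\<^esub> g \<in> carrier PU1" if fg: "f \<in> carrier PU1" "g \<in> carrier PU1"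
    for f g :: "'n option cproj \<Rightarrow> 'n option cproj"
  proof -
    obtain A B where AB: "A \<in> U1" "f = proj_act A" "B \<in> U1" "g = proj_act B"
      using fg by (auto simp: PU1_def)
    have "f \<circ> g = proj_act (A ** B)"
      using AB inv by (simp add: proj_act_mult)
    then show ?thesis using U1_mult[OF AB(1,3)] by (simp add: PU1_def)
  qed
  show "\<exists>g\<in>carrier PU1. g \<otimes>\<^bsub>PU1\<^esub> f = \<one>\<^bsub>PU1\<^esub>" if f: "f \<in> carrier PU1"
    for f :: "'n option cproj \<Rightarrow> 'n option cproj"
  proof -
    obtain A where A: "A \<in> U1" "f = proj_act A" using f by (auto simp: PU1_def)
    obtain B where B: "B \<in> U1" "B ** A = mat 1" using U1_inverse[OF A(1)] by blast
    have "proj_act B \<circ> f = id"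
      using A B inv by (metis proj_act_mult proj_act_one)
    then show ?thesis using B(1) by (auto simp: PU1_def)
  qed
qed (auto simp: PU1_def o_assoc)

text \<open>\<open>PU(1, n)\<close> carries the quotient topology from \<open>U(1, n)\<close>.\<close>

definition PU1_topology :: "(('n :: finite) option cproj \<Rightarrow> 'n option cproj) topology" where
  "PU1_topology = topology (\<lambda>W. W \<subseteq> carrier PU1 \<and>
     openin (top_of_set U1) {A \<in> U1. proj_act A \<in> W})"

lemma openin_PU1_topology:
  fixes W :: "(('n :: finite) option cproj \<Rightarrow> 'n option cproj) set"
  shows "openin PU1_topology W \<longleftrightarrow>
     W \<subseteq> carrier PU1 \<and> openin (top_of_set U1) {A \<in> U1. proj_act A \<in> W}"
proof -
  let ?P = "\<lambda>W :: ('n option cproj \<Rightarrow> 'n option cproj) set.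
    W \<subseteq> carrier PU1 \<and> openin (top_of_set U1) {A \<in> U1. proj_act A \<in> W}"
  have Int: "?P (S \<inter> T)" if "?P S" "?P T" for S T
  proof -
    have "{A \<in> U1. proj_act A \<in> S \<inter> T}
        = {A \<in> U1. proj_act A \<in> S} \<inter> {A \<in> U1. proj_act A \<in> T}" by blast
    then show ?thesis using that by (simp only: openin_Int le_infI1 simp_thms)
  qed
  have Union: "?P (\<Union>\<K>)" if *: "\<forall>K\<in>\<K>. ?P K" for \<K>
  proof -
    have "{A \<in> U1. proj_act A \<in> \<Union>\<K>} = (\<Union>K\<in>\<K>. {A \<in> U1. proj_act A \<in> K})" by blast
    moreover have "openin (top_of_set U1) (\<Union>K\<in>\<K>. {A \<in> U1. proj_act A \<in> K})"
      by (rule openin_Union) (use * in fast)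
    moreover have "\<Union>\<K> \<subseteq> carrier PU1"
      by (rule Union_least) (use * in fast)
    ultimately show ?thesis by (simp only: simp_thms)
  qed
  have "istopology ?P"
    unfolding istopology_def by (intro conjI[of "\<forall>S T. _ S T"] allI impI Int Union)
  then show ?thesis by (simp only: PU1_topology_def topology_inverse')
qed

lemma quotient_map_PU1:
  "quotient_map (top_of_set U1)
    (PU1_topology :: (('n :: finite) option cproj \<Rightarrow> 'n option cproj) topology) proj_act"
proof -
  let ?X = "PU1_topology :: ('n option cproj \<Rightarrow> 'n option cproj) topology"
  have eq: "{A \<in> U1. proj_act A \<in> proj_act ` U1} = U1" by blast
  have "openin ?X (carrier PU1)"
    unfolding openin_PU1_topology PU1_def partial_object.simps eq by simp
  moreover have "topspace ?X \<subseteq> carrier PU1"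
    using openin_topspace[of ?X] unfolding openin_PU1_topology by (rule conjunct1)
  ultimately have top: "topspace ?X = carrier PU1"
    by (intro subset_antisym openin_subset)
  show ?thesis
    unfolding quotient_map_def top openin_PU1_topology
    by (simp add: PU1_def)
qed

definition discrete_subgroup :: "(('n :: finite) option cproj \<Rightarrow> 'n option cproj) set \<Rightarrow> bool" where
  "discrete_subgroup G \<longleftrightarrow>
     subgroup G PU1 \<and> subtopology PU1_topology G = discrete_topology G"

definition complex_hyperbolic_space :: "('n :: finite) option cproj set" where
  "complex_hyperbolic_space = {proj u | u. Re (herm u u) < 0}"

definition hyperbolic_boundary :: "('n :: finite) option cproj set" where
  "hyperbolic_boundary = {proj u | u. u \<noteq> 0 \<and> herm u u = 0}"

text \<open>
  For \<open>p = [u]\<close> in \<open>hyperbolic_boundary\<close>, the real hyperplane tangent to the cone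
  \<open>herm u u = 0\<close> at \<open>u\<close> is \<open>Re (herm v u) = 0\<close>, and \<open>herm v u = 0\<close> is the only complex hyperplane in it.
\<close>

definition tangent_hyperplane :: "('n :: finite) option cproj \<Rightarrow> 'n option cproj set" where
  "tangent_hyperplane p = {proj v | u v. u \<noteq> 0 \<and> p = proj u \<and> v \<noteq> 0 \<and> herm v u = 0}"

text \<open>
  Points are counted with respect to group elements, not to distinct images: if infinitely many
  elements fix \<open>x\<close>, then \<open>x\<close> is an accumulation point of the orbit of \<open>{x}\<close>.
\<close>

definition orbit_accumulation_points ::
    "('a :: topological_space \<Rightarrow> 'a) set \<Rightarrow> 'a set \<Rightarrow> 'a set" where
  "orbit_accumulation_points G K =
     {z. \<forall>U. open U \<and> z \<in> U \<longrightarrow> infinite {g \<in> G. g ` K \<inter> U \<noteq> {}}}"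

definition chen_greenberg_limit_set ::
    "(('n :: finite) option cproj \<Rightarrow> 'n option cproj) set \<Rightarrow> 'n option cproj set" where
  "chen_greenberg_limit_set G =
     (complex_hyperbolic_space \<union> hyperbolic_boundary) \<inter>
     (\<Union>x\<in>complex_hyperbolic_space. orbit_accumulation_points G {x})"

definition normal_family_on ::
    "'a :: topological_space set \<Rightarrow> ('a \<Rightarrow> 'b :: metric_space) set \<Rightarrow> bool" where
  "normal_family_on U F \<longleftrightarrow>
     (\<forall>f :: nat \<Rightarrow> 'a \<Rightarrow> 'b. range f \<subseteq> F \<and> inj f \<longrightarrow>
        (\<exists>r h. strict_mono r \<and>
           (\<forall>K. compact K \<and> K \<subseteq> U \<longrightarrow> uniform_limit K (\<lambda>k. f (r k)) h sequentially)))"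

definition equicontinuity_region :: "('a :: metric_space \<Rightarrow> 'a) set \<Rightarrow> 'a set" where
  "equicontinuity_region G =
     {z. \<exists>U. open U \<and> z \<in> U \<and> normal_family_on U ((\<lambda>g. restrict g U) ` G)}"

definition acts_discontinuously_on ::
    "('a :: topological_space \<Rightarrow> 'a) set \<Rightarrow> 'a set \<Rightarrow> bool" where
  "acts_discontinuously_on G \<Omega> \<longleftrightarrow>
     open \<Omega> \<and> (\<forall>g\<in>G. g ` \<Omega> = \<Omega>) \<and>
     (\<forall>z\<in>\<Omega>. \<exists>U. open U \<and> z \<in> U \<and> U \<subseteq> \<Omega> \<and> finite {g \<in> G. g ` U \<inter> U \<noteq> {}})"

end

theory Submission
  imports Defs
begin

text \<open>
  Everything follows from how a sequence of distinct elements of a discrete group \<open>G\<close> behaves.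
  Lift the elements to matrices \<open>A k\<close> in \<open>U1\<close>. Discreteness forces the norms to infinity
  (\<open>discrete_subgroup_norm_at_top\<close>): otherwise a subsequence of lifts converges, and quotients of
  consecutive lifts give elements of \<open>G\<close> other than the identity that converge to it. After rescaling
  to norm one, a subsequence of \<open>A k\<close> converges to a nonzero matrix \<open>B\<close>. Since \<open>A k\<close> preserves the
  Hermitian form and the scaling factor tends to 0, the image of \<open>B\<close> is totally isotropic; signature
  \<open>(1, n)\<close> leaves only a line for it, spanned by a null vector \<open>w\<close>. The same holds for the adjoint of
  \<open>B\<close>, which is the limit of the rescaled inverses and whose image is spanned by a null vector \<open>w'\<close>.
  Hence \<open>B v\<close> is the multiple \<open>herm v w' *s w\<close> of \<open>w\<close>
  (\<open>isotropic_image_rank_one\<close>, \<open>U1_norm_at_top_degenerates\<close>).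

  So the transformations converge to the constant \<open>[w]\<close>, uniformly on compact sets that avoid the
  hyperplane tangent at \<open>[w']\<close> (\<open>degenerates_uniform_limit\<close>). Tangent hyperplanes miss hyperbolic
  space, so \<open>[w]\<close> and, by passing to inverses, \<open>[w']\<close> lie in the limit set; conversely every limit
  point is such a \<open>[w]\<close>. In particular the orbit of one interior point already determines the limit set,
  which is therefore closed, and so is the union of its tangent hyperplanes. On the
  complement \<open>\<Omega>\<close> of that union \<open>G\<close> is normal, and orbits of compact subsets of \<open>\<Omega>\<close> accumulate only
  at points \<open>[w]\<close>. Points of the limit set lie on their own tangent hyperplanes, hence outside \<open>\<Omega>\<close>,
  so only finitely many translates of a compact neighborhood of a point of \<open>\<Omega>\<close> come near that
  point, which gives discontinuity of the action.

  It remains to see that \<open>G\<close> is not normal near a point \<open>z\<close> of a hyperplane tangent at \<open>[w']\<close>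
  (\<open>degenerating_sequence_not_normal\<close>). A limit map would be continuous and equal to \<open>[w]\<close> off the
  hyperplane, hence equal to \<open>[w]\<close> at \<open>z\<close> too. But the preimages of a hyperplane \<open>Q\<close> that does not
  contain \<open>[w]\<close> converge to the tangent hyperplane, so there are points tending to \<open>z\<close> whose images
  stay in \<open>Q\<close>.
\<close>

section \<open>The Hermitian form\<close>

lemma scaleR_eq_smult: "r *\<^sub>R (u :: complex ^ 'a) = complex_of_real r *s u"
  by (simp add: vec_eq_iff scaleR_conv_of_real[where 'a = complex])

definition herm_sign :: "'n option \<Rightarrow> complex" where
  "herm_sign i = (if i = None then -1 else 1)"

lemma herm_sign_square [simp]: "herm_sign i * herm_sign i = 1" "herm_sign i * (herm_sign i * x) = x"
  "cnj (herm_sign i) = herm_sign i"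
  by (simp_all add: herm_sign_def)

lemma herm_eq_sum: "herm u v = (\<Sum>i\<in>UNIV. herm_sign i * u $ i * cnj (v $ i))"
  by (simp add: herm_def herm_sign_def UNIV_option_conv sum.reindex)

lemma herm_add_left: "herm (u + v) w = herm u w + herm v w"
  and herm_diff_left: "herm (u - v) w = herm u w - herm v w"
  and herm_diff_right: "herm w (u - v) = herm w u - herm w v"
  and herm_smult_left: "herm (c *s u) w = c * herm u w"
  and herm_smult_right: "herm w (c *s u) = cnj c * herm w u"
  by (simp_all add: herm_eq_sum sum.distrib sum_subtractf sum_distrib_left algebra_simps)

lemma herm_commute: "herm v u = cnj (herm u v)"
  by (simp add: herm_eq_sum mult_ac)

lemma herm_self_None_zero:
  assumes "u $ None = 0"
  shows "herm u u = complex_of_real ((norm u)\<^sup>2)"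
  using assms unfolding norm_square_complex_vec
  by (simp add: herm_def UNIV_option_conv sum.reindex)

lemma tendsto_herm [tendsto_intros]:
  assumes "(f \<longlongrightarrow> u) F" "(g \<longlongrightarrow> v) F"
  shows "((\<lambda>x. herm (f x) (g x)) \<longlongrightarrow> herm u v) F"
  unfolding herm_def by (intro tendsto_intros assms)

lemma herm_nondegenerate:
  assumes "\<And>u. herm u a = herm u b"
  shows "a = b"
proof -
  have "cnj (a $ i) = cnj (b $ i)" for i
  proof -
    have "herm_sign i * cnj (x $ i) = herm (axis i 1) x" for x :: "complex ^ 'a option"
      by (simp add: herm_eq_sum axis_def if_distrib if_distribR cong: if_cong)
    then have "herm_sign i * cnj (a $ i) = herm_sign i * cnj (b $ i)"
      using assms by metis
    then show ?thesis by (simp add: herm_sign_def split: if_splits)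
  qed
  then show ?thesis by (simp add: vec_eq_iff)
qed

text \<open>
  On vectors with vanishing \<open>None\<close> coordinate the form is the square of the norm.
\<close>

lemma herm_nonpos_None_nonzero:
  assumes "u \<noteq> 0" "Re (herm u u) \<le> 0"
  shows "u $ None \<noteq> 0"
proof
  assume "u $ None = 0"
  then have "(norm u)\<^sup>2 \<le> 0" using assms(2) herm_self_None_zero[of u] by simp
  then show False using assms(1) by simp
qed

text \<open>
  Isotropic subspaces are at most one-dimensional. The difference \<open>w - t *s x\<close> with vanishing
  \<open>None\<close> coordinate lies where the form is positive definite, while orthogonality makes the form
  nonpositive on it.
\<close>

lemma orthogonal_nonpos_parallel:
  assumes "x \<noteq> 0" "Re (herm x x) \<le> 0" "Re (herm w w) \<le> 0" "herm w x = 0"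
  obtains t where "w = t *s x"
proof -
  have x0: "x $ None \<noteq> 0" using herm_nonpos_None_nonzero assms by blast
  define t where "t = w $ None / x $ None"
  define y where "y = w - t *s x"
  have "y $ None = 0" using x0 by (simp add: y_def t_def)
  then have "herm y y = complex_of_real ((norm y)\<^sup>2)" by (rule herm_self_None_zero)
  moreover have "herm y y = herm w w + (t * cnj t) * herm x x"
    using assms(4) herm_commute[of x w]
    by (simp add: y_def herm_diff_left herm_diff_right herm_smult_left herm_smult_right
        algebra_simps)
  moreover have "Re ((t * cnj t) * herm x x) \<le> 0"
    using assms(2) by (simp add: complex_norm_square[symmetric] mult_nonneg_nonpos)
  ultimately have "(norm y)\<^sup>2 \<le> 0" using assms(3) by (metis Re_complex_of_real add_nonpos_nonpos plus_complex.sel(1))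
  then have "y = 0" by simp
  then show ?thesis using that[of t] by (simp add: y_def)
qed

lemma negative_null_not_orthogonal:
  assumes "Re (herm x x) < 0" "w \<noteq> 0" "herm w w = 0"
  shows "herm x w \<noteq> 0"
proof
  assume *: "herm x w = 0"
  obtain t where t: "x = t *s w"
    by (rule orthogonal_nonpos_parallel[OF assms(2), of x]) (use assms * in auto)
  then have "herm x x = 0" using assms(3) by (simp add: herm_smult_left herm_smult_right)
  then show False using assms(1) by simp
qed

section \<open>Adjoints and rank-one matrices\<close>

text \<open>
  The conjugate transpose, twisted by the signature so that it is the adjoint for the indefinite
  form. On \<open>U1\<close> it is the inverse; being given by the entries, it passes to limits.
\<close>

definition herm_adjoint :: "complex ^ ('n :: finite) option ^ 'n option \<Rightarrow> complex ^ 'n option ^ 'n option"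
  where "herm_adjoint A = (\<chi> i j. herm_sign i * herm_sign j * cnj (A $ j $ i))"

lemma herm_adjoint: "herm (A *v u) v = herm u (herm_adjoint A *v v)"
proof -
  have "herm (A *v u) v = (\<Sum>i\<in>UNIV. \<Sum>j\<in>UNIV. herm_sign i * (A $ i $ j * u $ j) * cnj (v $ i))"
    by (simp add: herm_eq_sum matrix_vector_mult_def sum_distrib_left sum_distrib_right mult_ac)
  also have "\<dots> = (\<Sum>j\<in>UNIV. \<Sum>i\<in>UNIV. herm_sign i * (A $ i $ j * u $ j) * cnj (v $ i))"
    by (rule sum.swap)
  also have "\<dots> = herm u (herm_adjoint A *v v)"
    by (simp add: herm_eq_sum matrix_vector_mult_def herm_adjoint_def sum_distrib_left mult_ac)
  finally show ?thesis .
qed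

lemma matrix_eqI_vector: "(\<And>v. A *v v = B *v v) \<Longrightarrow> A = (B :: complex ^ 'a ^ 'b)"
  by (simp add: matrix_eq)

lemma herm_adjoint_scaleR: "herm_adjoint (r *\<^sub>R A) = r *\<^sub>R herm_adjoint A"
  by (simp add: herm_adjoint_def vec_eq_iff scaleR_conv_of_real[where 'a = complex] mult_ac)

lemma tendsto_herm_adjoint [tendsto_intros]:
  assumes "(f \<longlongrightarrow> A) F"
  shows "((\<lambda>x. herm_adjoint (f x)) \<longlongrightarrow> herm_adjoint A) F"
  unfolding herm_adjoint_def by (intro tendsto_intros assms)

lemma tendsto_matrix_vector_mult [tendsto_intros]:
  fixes f :: "'b \<Rightarrow> complex ^ 'm ^ 'k"
  assumes "(f \<longlongrightarrow> A) F" "(g \<longlongrightarrow> u) F"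
  shows "((\<lambda>x. f x *v g x) \<longlongrightarrow> A *v u) F"
  unfolding matrix_vector_mult_def by (intro tendsto_intros assms)

lemma tendsto_matrix_matrix_mult [tendsto_intros]:
  fixes f :: "'b \<Rightarrow> complex ^ 'm ^ 'k"
  assumes "(f \<longlongrightarrow> A) F" "(g \<longlongrightarrow> B) F"
  shows "((\<lambda>x. f x ** g x) \<longlongrightarrow> A ** B) F"
  unfolding matrix_matrix_mult_def by (intro tendsto_intros assms)

lemma scaleR_matrix_vector: "(r *\<^sub>R A) *v u = r *\<^sub>R (A *v (u :: complex ^ 'a))"
  by (simp add: vec_eq_iff matrix_vector_mult_def scaleR_right.sum)

lemma U1_adjoint_inverse:
  assumes "A \<in> U1"
  shows "herm_adjoint A ** A = mat 1" "A ** herm_adjoint A = mat 1" "herm_adjoint A \<in> U1"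
proof -
  obtain B where B: "B \<in> U1" "B ** A = mat 1" using U1_inverse[OF assms] by blast
  have "A ** B = mat 1" using B(2) by (simp add: matrix_left_right_inverse)
  moreover have "B = herm_adjoint A"
  proof (rule matrix_eqI_vector, rule herm_nondegenerate)
    fix v u
    have "herm u (B *v v) = herm (A *v u) (A *v (B *v v))"
      using assms by (simp add: U1_def)
    then show "herm u (B *v v) = herm u (herm_adjoint A *v v)"
      using \<open>A ** B = mat 1\<close> by (simp add: matrix_vector_mul_assoc herm_adjoint)
  qed
  ultimately show "herm_adjoint A ** A = mat 1" "A ** herm_adjoint A = mat 1" "herm_adjoint A \<in> U1"
    using B by simp_all
qed

lemma U1_invertible: "A \<in> U1 \<Longrightarrow> invertible A"
  by (simp add: U1_def)

text \<open>
  The matrix of \<open>v \<mapsto> herm v w' *s w\<close>, see \<open>rank_one_mult\<close>.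
\<close>

definition rank_one :: "complex ^ ('n :: finite) option \<Rightarrow> complex ^ 'n option \<Rightarrow> complex ^ 'n option ^ 'n option"
  where "rank_one w w' = (\<chi> i j. w $ i * (herm_sign j * cnj (w' $ j)))"

lemma rank_one_mult: "rank_one w w' *v v = herm v w' *s w"
  by (simp add: rank_one_def herm_eq_sum matrix_vector_mult_def vec_eq_iff sum_distrib_left
      sum_distrib_right mult_ac)

lemma herm_adjoint_rank_one: "herm_adjoint (rank_one w w') = rank_one w' w"
  by (simp add: rank_one_def herm_adjoint_def vec_eq_iff mult_ac)

text \<open>
  An isotropic image is a line spanned by a null vector \<open>w\<close>, so \<open>B v = t v *s w\<close> for a linear form
  \<open>t\<close>. Writing \<open>t\<close> through the adjoint represents it by a vector \<open>w'\<close> in the image of the adjoint,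
  which is null for the same reason.
\<close>

lemma isotropic_image_rank_one:
  assumes B: "B \<noteq> 0" "\<And>u v. herm (B *v u) (B *v v) = 0"
    "\<And>u v. herm (herm_adjoint B *v u) (herm_adjoint B *v v) = 0"
  obtains w w' where "w \<noteq> 0" "herm w w = 0" "w' \<noteq> 0" "herm w' w' = 0" "B = rank_one w w'"
proof -
  obtain x where x: "B *v x \<noteq> 0" using B(1) matrix_eqI_vector[of B 0] by auto
  define w where "w = B *v x"
  have w: "w \<noteq> 0" "herm w w = 0" using x B(2) by (auto simp: w_def)
  have "\<exists>t. B *v v = t *s w" for v
    by (rule orthogonal_nonpos_parallel[of w "B *v v"]) (use w B(2) in \<open>auto simp: w_def\<close>)
  then obtain t where t: "\<And>v. B *v v = t v *s w" by metis
  \<comment> \<open>The coefficient is a linear form, read off by pairing with any vector not orthogonal to \<open>w\<close>.\<close>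
  obtain q where q: "herm w q \<noteq> 0"
    using herm_nondegenerate[of w 0] w(1) herm_commute
    by (metis complex_cnj_zero_iff herm_smult_right mult_zero_left vector_smult_lzero complex_cnj_zero)
  define w' where "w' = (1 / cnj (herm w q)) *s (herm_adjoint B *v q)"
  have "t v = herm v w'" for v
  proof -
    have "t v * herm w q = herm v (herm_adjoint B *v q)"
      unfolding herm_adjoint[symmetric] t by (simp add: herm_smult_left)
    then show ?thesis using q by (simp add: w'_def herm_smult_right field_simps)
  qed
  then have eq: "B = rank_one w w'"
    by (intro matrix_eqI_vector) (simp add: t rank_one_mult)
  have "herm w' w' = 0" using B(3) by (simp add: w'_def herm_smult_left herm_smult_right)
  moreover have "w' \<noteq> 0" using eq B(1) by (auto simp: rank_one_def vec_eq_iff)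
  ultimately show ?thesis using that w eq by blast
qed


section \<open>Projective space\<close>

lemma continuous_on_proj: "continuous_on (- {0}) (proj :: complex ^ ('a :: finite) \<Rightarrow> 'a cproj)"
  unfolding continuous_on_iff
proof (intro ballI allI impI)
  fix u :: "complex ^ 'a" and e :: real
  assume "u \<in> - {0}" "e > 0"
  then show "\<exists>d>0. \<forall>v\<in>- {0}. dist v u < d \<longrightarrow> dist (proj v) (proj u) < e"
    using continuous_on_line_projector[where 'a = 'a]
    by (auto simp: continuous_on_iff dist_cproj_def cproj_projector_proj)
qed

lemma tendsto_proj:
  assumes "(f \<longlongrightarrow> u) F" "u \<noteq> 0" "\<forall>\<^sub>F x in F. f x \<noteq> 0"
  shows "((\<lambda>x. proj (f x)) \<longlongrightarrow> proj u) F"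
  using assms continuous_on_tendsto_compose[OF continuous_on_proj assms(1)] by simp

lemma compact_UNIV_cproj: "compact (UNIV :: ('a :: finite) cproj set)"
proof -
  have "p \<in> proj ` sphere 0 1" for p :: "'a cproj"
  proof -
    define u where "u = rep_cproj p"
    have u: "u \<noteq> 0" "proj u = p" by (simp_all add: u_def rep_cproj_nonzero)
    have "proj ((1 / norm u) *\<^sub>R u) = p"
      using u proj_eq_iff[of u "(1 / norm u) *\<^sub>R u"]
      by (auto simp: scaleR_eq_smult intro!: exI[of _ "complex_of_real (1 / norm u)"])
    moreover have "(1 / norm u) *\<^sub>R u \<in> sphere 0 1" using u by simp
    ultimately show ?thesis by (metis image_eqI)
  qed
  then have "proj ` sphere 0 1 = (UNIV :: 'a cproj set)" by blast
  moreover have "compact (proj ` sphere (0 :: complex ^ 'a) 1)"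
    by (intro compact_continuous_image continuous_on_subset[OF continuous_on_proj]) auto
  ultimately show ?thesis by simp
qed

lemma closed_imp_compact_cproj: "closed S \<Longrightarrow> compact (S :: ('a :: finite) cproj set)"
  using compact_Int_closed[OF compact_UNIV_cproj] by simp

lemma convergent_subsequence_cproj:
  fixes f :: "nat \<Rightarrow> ('a :: finite) cproj"
  obtains l r where "strict_mono r" "(\<lambda>k. f (r k)) \<longlonglongrightarrow> l"
proof -
  have "\<forall>f :: nat \<Rightarrow> 'a cproj. \<exists>l r. strict_mono r \<and> (f \<circ> r) \<longlonglongrightarrow> l"
    using compact_UNIV_cproj[where 'a = 'a] unfolding compact_def by simp
  then show ?thesis using that by (auto simp: comp_def)
qed

text \<open>
  A representative of \<open>y k\<close> is only determined up to a scalar, and an arbitrary choice need not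
  converge. Projecting \<open>v\<close> orthogonally onto the line \<open>y k\<close> picks one that does; where the
  projection vanishes, which happens only finitely often, any representative serves.
\<close>

lemma lift_convergent_sequence:
  assumes "(\<lambda>k. y k) \<longlonglongrightarrow> proj v" "v \<noteq> 0"
  obtains u where "\<And>k. u k \<noteq> 0" "\<And>k. proj (u k) = y k" "u \<longlonglongrightarrow> v"
proof -
  define P where "P k = cproj_projector (y k) *v v" for k
  have "(\<lambda>k. cproj_projector (y k)) \<longlonglongrightarrow> line_projector v"
    using assms(1) unfolding tendsto_iff dist_cproj_def cproj_projector_proj[OF assms(2)] .
  then have P: "P \<longlonglongrightarrow> v"
    using tendsto_matrix_vector_mult[OF _ tendsto_const[of v]] line_projector_self[OF assms(2)]
    unfolding P_def by metis
  have proj_P: "proj (P k) = y k" if "P k \<noteq> 0" for k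
  proof -
    define w where "w = rep_cproj (y k)"
    have w: "w \<noteq> 0" "proj w = y k" by (simp_all add: w_def rep_cproj_nonzero)
    then obtain c where c: "P k = c *s w"
      unfolding P_def by (metis cproj_projector_proj line_projector_mult)
    then show ?thesis using w that proj_eq_iff[of w "P k"] by auto
  qed
  define u where "u k = (if P k = 0 then rep_cproj (y k) else P k)" for k
  have "\<forall>\<^sub>F k in sequentially. P k = u k"
    using tendsto_imp_eventually_ne[OF P assms(2)] by eventually_elim (simp add: u_def)
  then have "u \<longlonglongrightarrow> v" using P by (rule Lim_transform_eventually[rotated])
  then show ?thesis using that[of u] proj_P by (auto simp: u_def rep_cproj_nonzero)
qed

lemma herm_zero_proj_cong:
  assumes "u \<noteq> 0" "u' \<noteq> 0" "v \<noteq> 0" "v' \<noteq> 0" "proj u = proj u'" "proj v = proj v'"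
  shows "herm u v = 0 \<longleftrightarrow> herm u' v' = 0"
  using assms by (auto simp: proj_eq_iff herm_smult_left herm_smult_right)

text \<open>
  The vector \<open>u\<close> is arbitrary: for non-null \<open>u\<close> the set is the polar hyperplane of \<open>[u]\<close>, which
  later serves as a hyperplane avoiding a given boundary point.
\<close>

lemma proj_mem_tangent_hyperplane:
  assumes "u \<noteq> 0" "v \<noteq> 0"
  shows "proj v \<in> tangent_hyperplane (proj u) \<longleftrightarrow> herm v u = 0"
proof
  assume "proj v \<in> tangent_hyperplane (proj u)"
  then obtain u' v' where "u' \<noteq> 0" "v' \<noteq> 0" "proj u = proj u'" "proj v = proj v'" "herm v' u' = 0"
    unfolding tangent_hyperplane_def by blast
  then show "herm v u = 0" using herm_zero_proj_cong[of v v' u u'] assms by simp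
qed (use assms in \<open>auto simp: tangent_hyperplane_def\<close>)

text \<open>
  Orthogonality is a closed relation and projective space is compact.
\<close>

lemma closed_UN_tangent_hyperplane:
  fixes L :: "('n :: finite) option cproj set"
  assumes "closed L"
  shows "closed (\<Union>p\<in>L. tangent_hyperplane p)"
  unfolding closed_sequential_limits
proof (intro allI impI, elim conjE)
  fix z l assume z: "\<forall>k::nat. z k \<in> (\<Union>p\<in>L. tangent_hyperplane p)" "z \<longlonglongrightarrow> l"
  then have "\<forall>k. \<exists>q. q \<in> L \<and> z k \<in> tangent_hyperplane q" by blast
  from choice[OF this] obtain p
    where p: "\<And>k. p k \<in> L" "\<And>k. z k \<in> tangent_hyperplane (p k)"
    by blast
  obtain r q where r: "strict_mono (r :: nat \<Rightarrow> nat)" "(\<lambda>k. p (r k)) \<longlonglongrightarrow> q"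
    using convergent_subsequence_cproj .
  have "q \<in> L" using assms p(1) r(2) by (metis closed_sequential_limits)
  obtain u v where uv: "u \<noteq> 0" "proj u = q" "v \<noteq> 0" "proj v = l"
    using rep_cproj_nonzero proj_rep_cproj by metis
  obtain us where us: "\<And>k. us k \<noteq> 0" "\<And>k. proj (us k) = p (r k)" "us \<longlonglongrightarrow> u"
    using lift_convergent_sequence[of "\<lambda>k. p (r k)" u] r(2) uv by blast
  have "(\<lambda>k. z (r k)) \<longlonglongrightarrow> proj v"
    using LIMSEQ_subseq_LIMSEQ[OF z(2) r(1)] uv by (simp add: comp_def)
  then obtain vs where vs: "\<And>k. vs k \<noteq> 0" "\<And>k. proj (vs k) = z (r k)" "vs \<longlonglongrightarrow> v"
    using lift_convergent_sequence[of "\<lambda>k. z (r k)" v] uv by blast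
  have "herm (vs k) (us k) = 0" for k
    using p(2)[of "r k"] proj_mem_tangent_hyperplane[OF us(1) vs(1), of k k] us vs by simp
  then have "herm v u = 0"
    using tendsto_herm[OF vs(3) us(3)] by (simp add: LIMSEQ_const_iff)
  then show "l \<in> (\<Union>p\<in>L. tangent_hyperplane p)"
    using \<open>q \<in> L\<close> uv proj_mem_tangent_hyperplane by blast
qed

section \<open>Accumulation points of orbits as limits of sequences\<close>

text \<open>
  Accumulation is counted with respect to group elements, so infinitely many elements near \<open>z\<close>
  allow the choice of an injective sequence of them.
\<close>

lemma orbit_accumulation_points_sequential:
  fixes K :: "'a :: metric_space set"
  shows "z \<in> orbit_accumulation_points G K \<longleftrightarrow>
    (\<exists>g y. inj g \<and> range g \<subseteq> G \<and> range y \<subseteq> K \<and> (\<lambda>k::nat. g k (y k)) \<longlonglongrightarrow> z)"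
proof
  assume z: "z \<in> orbit_accumulation_points G K"
  define S where "S k = {g \<in> G. g ` K \<inter> ball z (1 / Suc k) \<noteq> {}}" for k
  have inf: "infinite (S k)" for k
    using z unfolding orbit_accumulation_points_def S_def by (auto simp del: of_nat_Suc)
  have "\<exists>g. \<forall>k. g k \<in> S k \<and> g k \<notin> g ` {..<k}"
  proof (rule dependent_wellorder_choice)
    show "\<exists>h. h \<in> S k \<and> h \<notin> f ` {..<k}" for k f
      using infinite_imp_nonempty[OF Diff_infinite_finite[OF _ inf[of k], of "f ` {..<k}"]] by auto
  qed (metis (no_types, lifting) image_cong lessThan_iff)
  then obtain g where g: "\<And>k. g k \<in> S k" "\<And>k. g k \<notin> g ` {..<k}" by blast
  have "inj g"
    by (rule linorder_injI) (use g(2) in \<open>metis image_eqI lessThan_iff\<close>)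
  have "\<exists>x\<in>K. dist z (g k x) < 1 / Suc k" for k
    using g(1)[of k] by (auto simp: S_def simp del: of_nat_Suc)
  then obtain y where y: "\<And>k. y k \<in> K" "\<And>k. dist z (g k (y k)) < 1 / Suc k" by metis
  have "norm (dist (g k (y k)) z) \<le> inverse (real (Suc k))" for k
    using y(2)[of k] by (simp add: dist_commute inverse_eq_divide)
  then have "(\<lambda>k. dist (g k (y k)) z) \<longlonglongrightarrow> 0"
    by (intro Lim_null_comparison[OF always_eventually LIMSEQ_inverse_real_of_nat] allI)
  then have "(\<lambda>k. g k (y k)) \<longlonglongrightarrow> z" by (subst tendsto_dist_iff)
  then show "\<exists>g y. inj g \<and> range g \<subseteq> G \<and> range y \<subseteq> K \<and> (\<lambda>k::nat. g k (y k)) \<longlonglongrightarrow> z"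
    using \<open>inj g\<close> g(1) y(1) by (intro exI[of _ g] exI[of _ y]) (auto simp: S_def)
next
  assume "\<exists>g y. inj g \<and> range g \<subseteq> G \<and> range y \<subseteq> K \<and> (\<lambda>k::nat. g k (y k)) \<longlonglongrightarrow> z"
  then obtain g y where g: "inj g" "range g \<subseteq> G" "range y \<subseteq> K" "(\<lambda>k::nat. g k (y k)) \<longlonglongrightarrow> z"
    by blast
  have "infinite {g \<in> G. g ` K \<inter> U \<noteq> {}}" if U: "open U" "z \<in> U" for U
  proof -
    obtain N where N: "\<And>k. k \<ge> N \<Longrightarrow> g k (y k) \<in> U"
      using topological_tendstoD[OF g(4) U] by (auto simp: eventually_sequentially)
    have "infinite (g ` {N..})"
      using g(1) by (metis finite_imageD inj_on_subset infinite_Ici subset_UNIV)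
    moreover have "g ` {N..} \<subseteq> {g \<in> G. g ` K \<inter> U \<noteq> {}}"
      using g N by blast
    ultimately show ?thesis using finite_subset by blast
  qed
  then show "z \<in> orbit_accumulation_points G K" by (simp add: orbit_accumulation_points_def)
qed

lemma closed_orbit_accumulation_points: "closed (orbit_accumulation_points G K)"
  unfolding closed_def
proof (subst open_subopen, intro ballI)
  fix z assume "z \<in> - orbit_accumulation_points G K"
  then obtain U where "open U" "z \<in> U" "finite {g \<in> G. g ` K \<inter> U \<noteq> {}}"
    unfolding orbit_accumulation_points_def by blast
  then show "\<exists>T. open T \<and> z \<in> T \<and> T \<subseteq> - orbit_accumulation_points G K"
    by (intro exI[of _ U]) (auto simp: orbit_accumulation_points_def)
qed

section \<open>Degenerating sequences\<close>

text \<open>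
  The matrices blow up in one direction only: after rescaling they converge to a matrix of rank one
  whose image is spanned by the attracting null vector \<open>w\<close> and whose kernel is the hyperplane
  orthogonal to the repelling null vector \<open>w'\<close>. Leaving the scaling factors \<open>t\<close> free, instead of
  normalizing by the norm, makes the notion stable under adjoints without comparing norms.
\<close>

definition degenerates ::
    "(nat \<Rightarrow> complex ^ ('n :: finite) option ^ 'n option) \<Rightarrow> complex ^ 'n option \<Rightarrow> complex ^ 'n option \<Rightarrow> bool"
  where
  "degenerates A w w' \<longleftrightarrow> (\<forall>k. A k \<in> U1) \<and>
    w \<noteq> 0 \<and> herm w w = 0 \<and> w' \<noteq> 0 \<and> herm w' w' = 0 \<and>
    (\<exists>t. (\<forall>k. t k > 0) \<and> (\<lambda>k. t k *\<^sub>R A k) \<longlonglongrightarrow> rank_one w w')"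

text \<open>
  Inverses exchange the attracting and the repelling vector.
\<close>

lemma degenerates_adjoint:
  assumes "degenerates A w w'"
  shows "degenerates (\<lambda>k. herm_adjoint (A k)) w' w"
proof -
  obtain t where t: "\<And>k. t k > 0" "(\<lambda>k. t k *\<^sub>R A k) \<longlonglongrightarrow> rank_one w w'"
    using assms by (auto simp: degenerates_def)
  then have "(\<lambda>k. t k *\<^sub>R herm_adjoint (A k)) \<longlonglongrightarrow> rank_one w' w"
    using tendsto_herm_adjoint[OF t(2)] by (simp add: herm_adjoint_scaleR herm_adjoint_rank_one)
  then show ?thesis
    using assms t(1) U1_adjoint_inverse(3) unfolding degenerates_def by blast
qed

lemma degenerates_subseq:
  assumes "degenerates A w w'" "strict_mono r"
  shows "degenerates (\<lambda>k. A (r k)) w w'"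
proof -
  obtain t where t: "\<And>k. t k > 0" "(\<lambda>k. t k *\<^sub>R A k) \<longlonglongrightarrow> rank_one w w'"
    using assms by (auto simp: degenerates_def)
  then show ?thesis
    using assms LIMSEQ_subseq_LIMSEQ[OF t(2) assms(2)] unfolding degenerates_def
    by (auto simp: comp_def intro!: exI[of _ "\<lambda>k. t (r k)"])
qed

text \<open>
  The rescaled matrices applied to convergent lifts of \<open>y k\<close> tend to \<open>herm v w' *s w\<close>, where \<open>v\<close>
  lifts \<open>z\<close>, and this is nonzero exactly because \<open>z\<close> is off the tangent hyperplane. Moving points
  \<open>y k\<close> are allowed because this is what uniform convergence on compact sets amounts to.
\<close>

lemma degenerates_tendsto:
  assumes A: "degenerates A w w'" and y: "y \<longlonglongrightarrow> z" "z \<notin> tangent_hyperplane (proj w')"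
  shows "(\<lambda>k. proj_act (A k) (y k)) \<longlonglongrightarrow> proj w"
proof -
  obtain t where t: "\<And>k. t k > 0" "(\<lambda>k. t k *\<^sub>R A k) \<longlonglongrightarrow> rank_one w w'"
    using A by (auto simp: degenerates_def)
  have w: "w \<noteq> 0" "w' \<noteq> 0" and inv: "\<And>k. invertible (A k)"
    using A by (auto simp: degenerates_def U1_invertible)
  obtain v where v: "v \<noteq> 0" "proj v = z" using rep_cproj_nonzero proj_rep_cproj by metis
  obtain u where u: "\<And>k. u k \<noteq> 0" "\<And>k. proj (u k) = y k" "u \<longlonglongrightarrow> v"
    using lift_convergent_sequence[of y v] y v by blast
  have vw: "herm v w' \<noteq> 0" using y(2) v w proj_mem_tangent_hyperplane by blast
  have nz: "t k *\<^sub>R (A k *v u k) \<noteq> 0" for k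
    using t(1)[of k] invertible_mult_nonzero[OF inv u(1)] by simp
  have eq: "proj_act (A k) (y k) = proj (t k *\<^sub>R (A k *v u k))" for k
  proof -
    have "proj_act (A k) (y k) = proj (A k *v u k)"
      using proj_act_proj[OF inv u(1)] u(2) by metis
    also have "\<dots> = proj (t k *\<^sub>R (A k *v u k))"
      using nz[of k] t(1)[of k] by (subst proj_eq_iff) (auto simp: scaleR_eq_smult)
    finally show ?thesis .
  qed
  have "(\<lambda>k. t k *\<^sub>R (A k *v u k)) \<longlonglongrightarrow> herm v w' *s w"
    using tendsto_matrix_vector_mult[OF t(2) u(3)] by (simp add: scaleR_matrix_vector rank_one_mult)
  then have "(\<lambda>k. proj (t k *\<^sub>R (A k *v u k))) \<longlonglongrightarrow> proj (herm v w' *s w)"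
    by (rule tendsto_proj) (use vw w nz in auto)
  moreover have "proj (herm v w' *s w) = proj w"
    using vw w by (metis proj_eq_iff vector_mul_eq_0)
  ultimately show ?thesis by (simp add: eq)
qed

text \<open>
  Continuous convergence along all subsequences gives uniform convergence: a failure of uniformity
  picks bad points in \<open>K\<close> along a subsequence, and by compactness these may be taken convergent.
\<close>

lemma uniform_limit_const_sequential:
  fixes f :: "nat \<Rightarrow> 'a :: metric_space \<Rightarrow> 'b :: metric_space"
  assumes "compact K"
    "\<And>r y z. strict_mono r \<Longrightarrow> range y \<subseteq> K \<Longrightarrow> z \<in> K \<Longrightarrow> y \<longlonglongrightarrow> z \<Longrightarrow>
      (\<lambda>k. f (r k) (y k)) \<longlonglongrightarrow> l"
  shows "uniform_limit K f (\<lambda>_. l) sequentially"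
proof (rule ccontr)
  assume "\<not> ?thesis"
  then obtain e where e: "e > 0" "\<not> (\<forall>\<^sub>F k in sequentially. \<forall>x\<in>K. dist (f k x) l < e)"
    by (auto simp: uniform_limit_iff)
  let ?S = "{k. \<exists>x\<in>K. dist (f k x) l \<ge> e}"
  have inf: "infinite ?S"
    using e(2) unfolding eventually_sequentially infinite_nat_iff_unbounded_le
    by (simp add: not_less)
  define s where "s = enumerate ?S"
  have s: "strict_mono s" "\<And>k. s k \<in> ?S"
    unfolding s_def using strict_mono_enumerate[OF inf] enumerate_in_set[OF inf] by auto
  then obtain y where y: "\<And>k. y k \<in> K" "\<And>k. dist (f (s k) (y k)) l \<ge> e"
    by simp metis
  obtain z r where r: "z \<in> K" "strict_mono r" "(y \<circ> r) \<longlonglongrightarrow> z"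
    using assms(1) y(1) unfolding compact_def by metis
  have "(\<lambda>k. f ((s \<circ> r) k) ((y \<circ> r) k)) \<longlonglongrightarrow> l"
    using s(1) r y(1) by (intro assms(2)[of "s \<circ> r" "y \<circ> r" z]) (auto intro: strict_mono_o)
  then have "\<forall>\<^sub>F k in sequentially. dist (f (s (r k)) (y (r k))) l < e"
    using e(1) by (simp add: tendsto_iff)
  then show False
    using y(2) by (auto simp: eventually_sequentially not_less[symmetric])
qed

lemma degenerates_uniform_limit:
  assumes "degenerates A w w'" "compact K" "K \<inter> tangent_hyperplane (proj w') = {}"
  shows "uniform_limit K (\<lambda>k. proj_act (A k)) (\<lambda>_. proj w) sequentially"
  using assms(2)
proof (rule uniform_limit_const_sequential)
  fix r :: "nat \<Rightarrow> nat" and y z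
  assume "strict_mono r" "z \<in> K" "y \<longlonglongrightarrow> z"
  then show "(\<lambda>k. proj_act (A (r k)) (y k)) \<longlonglongrightarrow> proj w"
    using degenerates_tendsto[OF degenerates_subseq[OF assms(1)]] assms(3) by blast
qed

section \<open>Discreteness forces degeneration\<close>

lemma closed_U1: "closed (U1 :: (complex ^ ('n :: finite) option ^ 'n option) set)"
proof -
  have eq: "(U1 :: (complex ^ 'n option ^ 'n option) set) = {A. herm_adjoint A ** A = mat 1}"
  proof (intro equalityI subsetI)
    fix A :: "complex ^ 'n option ^ 'n option"
    assume "A \<in> {A. herm_adjoint A ** A = mat 1}"
    then have *: "herm_adjoint A ** A = mat 1" by simp
    then have "invertible A" using matrix_left_right_inverse invertible_def by blast
    moreover have "herm (A *v u) (A *v v) = herm u v" for u v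
      by (simp add: herm_adjoint matrix_vector_mul_assoc *)
    ultimately show "A \<in> U1" by (simp add: U1_def)
  qed (simp add: U1_adjoint_inverse)
  have "herm_adjoint B ** B = mat 1"
    if "\<And>k. herm_adjoint (A k) ** A k = mat 1" "A \<longlonglongrightarrow> B"
    for A and B :: "complex ^ 'n option ^ 'n option"
    using tendsto_matrix_matrix_mult[OF tendsto_herm_adjoint[OF that(2)] that(2)]
    by (simp add: that(1) LIMSEQ_const_iff)
  then show ?thesis unfolding closed_sequential_limits eq by blast
qed

text \<open>
  The quotient topology turns an isolated identity of \<open>G\<close> into a neighborhood of the identity
  matrix.
\<close>

lemma discrete_subgroup_identity_isolated:
  fixes G :: "(('n :: finite) option cproj \<Rightarrow> 'n option cproj) set"
  assumes "discrete_subgroup G"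
  obtains T where "open T" "mat 1 \<in> T"
    "\<And>A. A \<in> U1 \<Longrightarrow> A \<in> T \<Longrightarrow> proj_act A \<in> G \<Longrightarrow> proj_act A = id"
proof -
  have "id \<in> G"
    using assms subgroup.one_closed[of G PU1] by (simp add: discrete_subgroup_def PU1_def)
  then have "openin (subtopology PU1_topology G) {id}"
    using assms by (simp add: discrete_subgroup_def)
  then obtain W where W: "openin PU1_topology W" "W \<inter> G = {id}"
    by (auto simp: openin_subtopology)
  then obtain T where T: "open T" "{A \<in> U1. proj_act A \<in> W} = U1 \<inter> T"
    unfolding openin_PU1_topology openin_open by blast
  have "mat 1 \<in> {A \<in> U1. proj_act A \<in> W}" using U1_one W(2) by (auto simp: proj_act_one)
  then show ?thesis using that[of T] T W(2) by blast
qed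

lemma discrete_subgroup_PU1:
  assumes "discrete_subgroup G" "g \<in> G"
  shows "\<exists>A\<in>U1. g = proj_act A"
  using assms subgroup.subset[of G PU1] by (auto simp: discrete_subgroup_def PU1_def)

lemma discrete_subgroup_comp:
  assumes "discrete_subgroup G" "g \<in> G" "h \<in> G"
  shows "g \<circ> h \<in> G"
  using assms subgroup.m_closed[of G PU1 g h] by (simp add: discrete_subgroup_def PU1_def)

lemma proj_act_adjoint:
  assumes "A \<in> U1"
  shows "proj_act (herm_adjoint A) \<circ> proj_act A = id" "proj_act A \<circ> proj_act (herm_adjoint A) = id"
  using U1_adjoint_inverse[OF assms] U1_invertible assms
  by (metis proj_act_mult proj_act_one)+

lemma discrete_subgroup_adjoint:
  assumes "discrete_subgroup G" "A \<in> U1" "proj_act A \<in> G"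
  shows "proj_act (herm_adjoint A) \<in> G"
proof -
  have sub: "subgroup G PU1" using assms(1) by (simp add: discrete_subgroup_def)
  have "proj_act (herm_adjoint A) = inv\<^bsub>PU1\<^esub> (proj_act A)"
    using group.inv_equality[OF group_PU1, of "proj_act (herm_adjoint A)" "proj_act A"]
      proj_act_adjoint[OF assms(2)] assms(2) U1_adjoint_inverse(3)[OF assms(2)]
    by (auto simp: PU1_def)
  then show ?thesis using subgroup.m_inv_closed[OF sub assms(3)] by simp
qed

text \<open>
  If the lifts converged, the quotients of consecutive ones would tend to the identity matrix, so
  two consecutive group elements would coincide.
\<close>

lemma discrete_subgroup_no_convergent_lifts:
  assumes G: "discrete_subgroup G" and A: "\<And>k. A k \<in> U1" "\<And>k. proj_act (A k) \<in> G"
    "inj (\<lambda>k::nat. proj_act (A k))"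
  shows "\<not> A \<longlonglongrightarrow> B"
proof
  assume lim: "A \<longlonglongrightarrow> B"
  then have B: "B \<in> U1" using closed_U1 A(1) by (metis closed_sequential_limits)
  obtain T where T: "open T" "mat 1 \<in> T"
    "\<And>A. A \<in> U1 \<Longrightarrow> A \<in> T \<Longrightarrow> proj_act A \<in> G \<Longrightarrow> proj_act A = id"
    using discrete_subgroup_identity_isolated[OF G] by metis
  have "(\<lambda>k. herm_adjoint (A k) ** A (Suc k)) \<longlonglongrightarrow> herm_adjoint B ** B"
    by (intro tendsto_intros lim LIMSEQ_Suc)
  then have "\<forall>\<^sub>F k in sequentially. herm_adjoint (A k) ** A (Suc k) \<in> T"
    using T by (intro topological_tendstoD) (auto simp: U1_adjoint_inverse[OF B])
  then obtain k where k: "herm_adjoint (A k) ** A (Suc k) \<in> T"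
    by (auto simp: eventually_sequentially)
  have inv: "invertible (herm_adjoint (A k))" "invertible (A (Suc k))"
    using A(1) U1_adjoint_inverse(3) U1_invertible by blast+
  have "proj_act (herm_adjoint (A k) ** A (Suc k)) \<in> G"
    unfolding proj_act_mult[OF inv]
    by (intro discrete_subgroup_comp discrete_subgroup_adjoint G A)
  then have "proj_act (herm_adjoint (A k)) \<circ> proj_act (A (Suc k)) = id"
    using T(3)[OF U1_mult k] A(1) U1_adjoint_inverse(3) proj_act_mult[OF inv] by metis
  then have "proj_act (A k) \<circ> (proj_act (herm_adjoint (A k)) \<circ> proj_act (A (Suc k))) = proj_act (A k)"
    by simp
  then have "proj_act (A (Suc k)) = proj_act (A k)"
    unfolding o_assoc proj_act_adjoint[OF A(1)] by simp
  then show False using A(3) by (metis injD n_not_Suc_n)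
qed

lemma discrete_subgroup_norm_at_top:
  assumes G: "discrete_subgroup G" and A: "\<And>k. A k \<in> U1" "\<And>k. proj_act (A k) \<in> G"
    "inj (\<lambda>k::nat. proj_act (A k))"
  shows "filterlim (\<lambda>k. norm (A k)) at_top sequentially"
proof (rule ccontr)
  assume "\<not> ?thesis"
  then obtain Z where Z: "\<not> (\<forall>\<^sub>F k in sequentially. Z \<le> norm (A k))"
    by (auto simp: filterlim_at_top)
  let ?S = "{k. norm (A k) \<le> Z}"
  have inf: "infinite ?S"
    using Z unfolding eventually_sequentially infinite_nat_iff_unbounded_le
    by simp (metis linorder_le_cases)
  define s where "s = enumerate ?S"
  have s: "strict_mono s" "\<And>k. s k \<in> ?S"
    unfolding s_def using strict_mono_enumerate[OF inf] enumerate_in_set[OF inf] by auto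
  have "compact (cball (0 :: complex ^ 'a option ^ 'a option) Z)" by simp
  moreover have "\<forall>k. (A \<circ> s) k \<in> cball 0 Z" using s(2) by simp
  ultimately obtain B r where r: "strict_mono r" "(A \<circ> s \<circ> r) \<longlonglongrightarrow> B"
    unfolding compact_def by metis
  have "inj (\<lambda>k. proj_act (A (s (r k))))"
    using inj_compose[OF A(3) strict_mono_imp_inj_on[OF strict_mono_o[OF s(1) r(1)]]]
    by (simp add: comp_def)
  then show False
    using discrete_subgroup_no_convergent_lifts[OF G, of "A \<circ> s \<circ> r" B] A r(2) by simp
qed

text \<open>
  The form of two rescaled images is the original form times the square of a factor that tends to
  zero; hence the limits of the rescaled matrices and of their adjoints have isotropic images.
\<close>

lemma U1_norm_at_top_degenerates:
  fixes A :: "nat \<Rightarrow> complex ^ ('n :: finite) option ^ 'n option"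
  assumes A: "\<And>k. A k \<in> U1" and lim: "filterlim (\<lambda>k. norm (A k)) at_top sequentially"
  obtains r w w' where "strict_mono r" "degenerates (\<lambda>k. A (r k)) w w'"
proof -
  define t where "t k = inverse (norm (A k))" for k
  have t: "t k > 0" for k
    using U1_invertible[OF A, of k] invertible_mult_nonzero[of "A k" 1]
    by (cases "A k = 0") (auto simp: t_def)
  have t0: "t \<longlonglongrightarrow> 0"
    unfolding t_def using lim by (rule tendsto_inverse_0_at_top)
  have "\<forall>k. t k *\<^sub>R A k \<in> sphere 0 1" using t by (simp add: t_def)
  then obtain B r where r: "B \<in> sphere 0 1" "strict_mono r" "((\<lambda>k. t k *\<^sub>R A k) \<circ> r) \<longlonglongrightarrow> B"
    by (rule seq_compactE[OF compact_imp_seq_compact[OF compact_sphere]])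
  have tr: "(\<lambda>k. t (r k)) \<longlonglongrightarrow> 0" using LIMSEQ_subseq_LIMSEQ[OF t0 r(2)] by (simp add: comp_def)
  have isotropic: "herm (D *v u) (D *v v) = 0"
    if C: "\<And>k. C k \<in> U1" "(\<lambda>k. t (r k) *\<^sub>R C k) \<longlonglongrightarrow> D"
    for C and D :: "complex ^ 'n option ^ 'n option" and u v
  proof -
    have "(\<lambda>k. herm ((t (r k) *\<^sub>R C k) *v u) ((t (r k) *\<^sub>R C k) *v v)) \<longlonglongrightarrow> herm (D *v u) (D *v v)"
      by (intro tendsto_intros C(2))
    moreover have "herm ((t (r k) *\<^sub>R C k) *v u) ((t (r k) *\<^sub>R C k) *v v)
        = complex_of_real (t (r k)) * complex_of_real (t (r k)) * herm u v" for k
      using C(1)[of k]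
      by (simp add: scaleR_matrix_vector scaleR_eq_smult herm_smult_left herm_smult_right U1_def)
    moreover have "(\<lambda>k. complex_of_real (t (r k)) * complex_of_real (t (r k)) * herm u v)
        \<longlonglongrightarrow> complex_of_real 0 * complex_of_real 0 * herm u v"
      by (intro tendsto_intros tr)
    ultimately show ?thesis using LIMSEQ_unique by fastforce
  qed
  have lim_B: "(\<lambda>k. t (r k) *\<^sub>R A (r k)) \<longlonglongrightarrow> B" using r(3) by (simp add: comp_def)
  have lim_adj: "(\<lambda>k. t (r k) *\<^sub>R herm_adjoint (A (r k))) \<longlonglongrightarrow> herm_adjoint B"
    using tendsto_herm_adjoint[OF lim_B] by (simp add: herm_adjoint_scaleR)
  obtain w w' where w: "w \<noteq> 0" "herm w w = 0" "w' \<noteq> 0" "herm w' w' = 0" "B = rank_one w w'"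
  proof (rule isotropic_image_rank_one)
    show "B \<noteq> 0" using r(1) by auto
    show "herm (B *v u) (B *v v) = 0" for u v
      by (rule isotropic[OF A lim_B])
    show "herm (herm_adjoint B *v u) (herm_adjoint B *v v) = 0" for u v
      by (rule isotropic[OF U1_adjoint_inverse(3)[OF A] lim_adj])
  qed
  have "degenerates (\<lambda>k. A (r k)) w w'"
    unfolding degenerates_def using A t w lim_B by (auto intro!: exI[of _ "\<lambda>k. t (r k)"])
  then show ?thesis using that r(2) by blast
qed

section \<open>The limit set\<close>

text \<open>
  A degenerating sequence of lifts of distinct elements of \<open>G\<close>; its attracting points \<open>[w]\<close> will turn
  out to be exactly the limit points.
\<close>

definition degenerates_in ::
    "(('n :: finite) option cproj \<Rightarrow> 'n option cproj) set \<Rightarrow> (nat \<Rightarrow> complex ^ 'n option ^ 'n option)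
      \<Rightarrow> complex ^ 'n option \<Rightarrow> complex ^ 'n option \<Rightarrow> bool"
  where
  "degenerates_in G A w w' \<longleftrightarrow>
    degenerates A w w' \<and> (\<forall>k. proj_act (A k) \<in> G) \<and> inj (\<lambda>k. proj_act (A k))"

lemma degenerates_in_adjoint:
  assumes "discrete_subgroup G" "degenerates_in G A w w'"
  shows "degenerates_in G (\<lambda>k. herm_adjoint (A k)) w' w"
proof -
  have U1: "A k \<in> U1" for k
    using assms(2) by (simp add: degenerates_in_def degenerates_def)
  have "proj_act (A k) = proj_act (A l)"
    if "proj_act (herm_adjoint (A k)) = proj_act (herm_adjoint (A l))" for k l
  proof -
    have "proj_act (A k) = proj_act (A k) \<circ> (proj_act (herm_adjoint (A l)) \<circ> proj_act (A l))"
      by (simp add: proj_act_adjoint[OF U1])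
    then show ?thesis unfolding that[symmetric] o_assoc proj_act_adjoint[OF U1] by simp
  qed
  note eq = this
  have "inj (\<lambda>k. proj_act (A k))" using assms(2) by (simp add: degenerates_in_def)
  then have "inj (\<lambda>k. proj_act (herm_adjoint (A k)))"
    by (intro injI) (rule injD, assumption, rule eq)
  then show ?thesis
    using assms U1 discrete_subgroup_adjoint[OF assms(1)]
    by (auto simp: degenerates_in_def degenerates_adjoint)
qed

text \<open>
  The vector \<open>axis None 1\<close> represents the center of the ball.
\<close>

lemma origin_negative: "Re (herm (axis None 1) (axis None 1)) < 0"
  by (simp add: herm_def axis_def)

lemma origin_in_hyperbolic_space: "proj (axis None 1) \<in> complex_hyperbolic_space"
  using origin_negative by (auto simp: complex_hyperbolic_space_def)

text \<open>
  A negative vector is never orthogonal to a nonzero null vector.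
\<close>

lemma tangent_hyperplane_disjoint_hyperbolic_space:
  assumes "p \<in> complex_hyperbolic_space" "w \<noteq> 0" "herm w w = 0"
  shows "p \<notin> tangent_hyperplane (proj w)"
proof -
  obtain x where x: "p = proj x" "Re (herm x x) < 0"
    using assms(1) by (auto simp: complex_hyperbolic_space_def)
  then have "x \<noteq> 0" by (auto simp: herm_def)
  then show ?thesis
    using proj_mem_tangent_hyperplane[OF assms(2), of x] x
      negative_null_not_orthogonal[OF x(2) assms(2,3)] by simp
qed

lemma degenerates_in_accumulates:
  assumes A: "degenerates_in G A w w'" and p: "p \<in> complex_hyperbolic_space"
  shows "proj w \<in> orbit_accumulation_points G {p}"
proof -
  have "p \<notin> tangent_hyperplane (proj w')"
    using A tangent_hyperplane_disjoint_hyperbolic_space[OF p]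
    by (simp add: degenerates_in_def degenerates_def)
  then have "(\<lambda>k. proj_act (A k) p) \<longlonglongrightarrow> proj w"
    using degenerates_tendsto[of A w w' "\<lambda>_. p" p] A by (simp add: degenerates_in_def)
  then show ?thesis
    unfolding orbit_accumulation_points_sequential using A
    by (intro exI[of _ "\<lambda>k. proj_act (A k)"] exI[of _ "\<lambda>_. p"]) (auto simp: degenerates_in_def)
qed

lemma degenerates_in_limit_set:
  assumes "degenerates_in G A w w'"
  shows "proj w \<in> chen_greenberg_limit_set G"
proof -
  have "proj w \<in> hyperbolic_boundary"
    using assms by (auto simp: degenerates_in_def degenerates_def hyperbolic_boundary_def)
  then show ?thesis
    using degenerates_in_accumulates[OF assms] origin_in_hyperbolic_space
    unfolding chen_greenberg_limit_set_def by blast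
qed

lemma discrete_subgroup_degenerating_subsequence:
  assumes G: "discrete_subgroup G" and g: "inj (g :: nat \<Rightarrow> _)" "range g \<subseteq> G"
  obtains r A w w' where "strict_mono r" "degenerates_in G A w w'" "\<forall>k. proj_act (A k) = g (r k)"
proof -
  have "\<forall>k. \<exists>A. A \<in> U1 \<and> g k = proj_act A"
    using discrete_subgroup_PU1[OF G] g(2) by blast
  from choice[OF this] obtain A where A: "\<And>k. A k \<in> U1" "\<And>k. g k = proj_act (A k)"
    by blast
  have inj: "inj (\<lambda>k. proj_act (A k))" using g(1) A(2) by (simp add: inj_def)
  have inG: "proj_act (A k) \<in> G" for k using g(2) A(2) by (metis range_subsetD)
  obtain r w w' where r: "strict_mono r" "degenerates (\<lambda>k. A (r k)) w w'"
    using U1_norm_at_top_degenerates[OF A(1) discrete_subgroup_norm_at_top[OF G A(1) inG inj]] .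
  have "inj (\<lambda>k. proj_act (A (r k)))"
    using inj_compose[OF inj strict_mono_imp_inj_on[OF r(1)]] by (simp add: comp_def)
  then have "degenerates_in G (\<lambda>k. A (r k)) w w'"
    using r(2) inG by (simp add: degenerates_in_def)
  then show ?thesis using that[OF r(1)] A(2) by simp
qed

text \<open>
  Along a subsequence the points of \<open>K\<close> that approach \<open>z\<close> under \<open>G\<close> converge in \<open>K\<close>, away from the
  repelling hyperplane, so their images tend to the attracting point. The hypothesis on \<open>K\<close> is
  restricted to null vectors so that it can be verified for a point of hyperbolic space before limit
  points are known to be null.
\<close>

lemma orbit_accumulation_point_is_attractor:
  fixes K :: "('n :: finite) option cproj set"
  assumes G: "discrete_subgroup G" and K: "compact K"
    and disj: "\<And>w. w \<noteq> 0 \<Longrightarrow> herm w w = 0 \<Longrightarrow> proj w \<in> chen_greenberg_limit_set G \<Longrightarrow>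
      K \<inter> tangent_hyperplane (proj w) = {}"
    and z: "z \<in> orbit_accumulation_points G K"
  obtains A w w' where "degenerates_in G A w w'" "z = proj w"
proof -
  obtain g y where g: "inj g" "range g \<subseteq> G" "range y \<subseteq> K" "(\<lambda>k::nat. g k (y k)) \<longlonglongrightarrow> z"
    using z unfolding orbit_accumulation_points_sequential by blast
  obtain r A w w' where r: "strict_mono r" "degenerates_in G A w w'"
    "\<forall>k. proj_act (A k) = g (r k)"
    by (rule discrete_subgroup_degenerating_subsequence[OF G g(1,2)])
  have "\<forall>k. (y \<circ> r) k \<in> K" using g(3) by auto
  then obtain l s where s: "l \<in> K" "strict_mono s" "((y \<circ> r) \<circ> s) \<longlonglongrightarrow> l"
    by (rule seq_compactE[OF compact_imp_seq_compact[OF K]])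
  have dA: "degenerates A w w'" using r(2) by (simp add: degenerates_in_def)
  then have w': "w' \<noteq> 0" "herm w' w' = 0" by (simp_all add: degenerates_def)
  have "proj w' \<in> chen_greenberg_limit_set G"
    using degenerates_in_limit_set[OF degenerates_in_adjoint[OF G r(2)]] .
  then have "l \<notin> tangent_hyperplane (proj w')" using disj[OF w'] s(1) by blast
  then have "(\<lambda>k. proj_act (A (s k)) (((y \<circ> r) \<circ> s) k)) \<longlonglongrightarrow> proj w"
    by (rule degenerates_tendsto[OF degenerates_subseq[OF dA s(2)] s(3)])
  moreover have "(\<lambda>k. proj_act (A (s k)) (((y \<circ> r) \<circ> s) k)) \<longlonglongrightarrow> z"
    using LIMSEQ_subseq_LIMSEQ[OF g(4) strict_mono_o[OF r(1) s(2)]] r(3) by (simp add: comp_def)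
  ultimately have "z = proj w" using LIMSEQ_unique by blast
  then show ?thesis using that r(2) by blast
qed

lemma hyperbolic_orbit_accumulation_point_is_attractor:
  assumes "discrete_subgroup G" "p \<in> complex_hyperbolic_space" "z \<in> orbit_accumulation_points G {p}"
  obtains A w w' where "degenerates_in G A w w'" "z = proj w"
proof (rule orbit_accumulation_point_is_attractor[OF assms(1) _ _ assms(3)])
  show "compact {p}" by simp
  show "{p} \<inter> tangent_hyperplane (proj w) = {}" if "w \<noteq> 0" "herm w w = 0" for w
    using tangent_hyperplane_disjoint_hyperbolic_space[OF assms(2) that] by simp
qed (rule that)

lemma limit_set_attractor:
  assumes "discrete_subgroup G" "z \<in> chen_greenberg_limit_set G"
  obtains A w w' where "degenerates_in G A w w'" "z = proj w"
proof -
  obtain p where p: "p \<in> complex_hyperbolic_space" "z \<in> orbit_accumulation_points G {p}"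
    using assms(2) unfolding chen_greenberg_limit_set_def by auto
  show ?thesis
    by (rule hyperbolic_orbit_accumulation_point_is_attractor[OF assms(1) p]) (rule that)
qed

text \<open>
  The attracting point does not depend on the interior point whose orbit is followed. This is what
  makes the limit set closed, as the accumulation points of one orbit.
\<close>

lemma limit_set_single_orbit:
  assumes "discrete_subgroup G" "p \<in> complex_hyperbolic_space"
  shows "chen_greenberg_limit_set G = orbit_accumulation_points G {p}"
proof (intro equalityI subsetI)
  fix z assume "z \<in> chen_greenberg_limit_set G"
  then obtain A w w' where "degenerates_in G A w w'" "z = proj w"
    using limit_set_attractor[OF assms(1)] by metis
  then show "z \<in> orbit_accumulation_points G {p}"
    using degenerates_in_accumulates assms(2) by blast
next
  fix z assume "z \<in> orbit_accumulation_points G {p}"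
  then obtain A w w' where "degenerates_in G A w w'" "z = proj w"
    using hyperbolic_orbit_accumulation_point_is_attractor[OF assms] by metis
  then show "z \<in> chen_greenberg_limit_set G"
    using degenerates_in_limit_set by blast
qed

lemma closed_limit_set:
  assumes "discrete_subgroup G"
  shows "closed (chen_greenberg_limit_set G)"
  using limit_set_single_orbit[OF assms origin_in_hyperbolic_space]
  by (simp add: closed_orbit_accumulation_points)

lemma limit_set_point_in_own_tangent_hyperplane:
  assumes "discrete_subgroup G" "p \<in> chen_greenberg_limit_set G"
  shows "p \<in> tangent_hyperplane p"
proof -
  obtain A w w' where A: "degenerates_in G A w w'" "p = proj w"
    using limit_set_attractor[OF assms] .
  then have "w \<noteq> 0" "herm w w = 0" by (simp_all add: degenerates_in_def degenerates_def)
  then show ?thesis using proj_mem_tangent_hyperplane A(2) by blast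
qed

section \<open>Normal families\<close>

text \<open>
  Normality speaks of injective sequences of restrictions, while the restrictions of \<open>g k\<close> may repeat.
  If they take finitely many values, a constant subsequence converges trivially; otherwise an
  injective subsequence exists.
\<close>

lemma normal_family_subsequence:
  fixes g :: "nat \<Rightarrow> 'a :: topological_space \<Rightarrow> 'b :: metric_space"
  assumes "normal_family_on U ((\<lambda>g. restrict g U) ` G)" "range g \<subseteq> G"
  obtains r h where "strict_mono (r :: nat \<Rightarrow> nat)"
    "\<forall>K. compact K \<and> K \<subseteq> U \<longrightarrow> uniform_limit K (\<lambda>k. g (r k)) h sequentially"
proof -
  define f where "f k = restrict (g k) U" for k
  have f: "f k x = g k x" if "x \<in> U" for k x using that by (simp add: f_def)
  show ?thesis
  proof (cases "finite (range f)")
    case True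
    then obtain j where j: "infinite {k. f k = f j}"
      using pigeonhole_infinite[of UNIV f] by auto
    define r where "r = enumerate {k. f k = f j}"
    have r: "strict_mono r" "\<And>k. f (r k) = f j"
      unfolding r_def using strict_mono_enumerate[OF j] enumerate_in_set[OF j] by auto
    have "uniform_limit K (\<lambda>k. g (r k)) (g j) sequentially" if "K \<subseteq> U" for K
    proof -
      have "g (r k) x = g j x" if "x \<in> K" for x k
        using f r(2) \<open>K \<subseteq> U\<close> that by (metis subsetD)
      then show ?thesis by (simp add: uniform_limit_iff)
    qed
    then show ?thesis using that[OF r(1)] by blast
  next
    case False
    \<comment> \<open>One index for each value of \<open>f\<close>, so that \<open>f\<close> is injective along these indices.\<close>
    let ?I = "{k. \<forall>j<k. f j \<noteq> f k}"
    have "f k \<in> f ` ?I" for k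
    proof -
      define m where "m = (LEAST j. f j = f k)"
      have m: "f m = f k" unfolding m_def by (rule LeastI) simp
      have "f j \<noteq> f m" if "j < m" for j
        using not_less_Least[of j "\<lambda>j. f j = f k"] that m by (simp add: m_def[symmetric])
      then show ?thesis using m by (intro image_eqI[of _ _ m]) auto
    qed
    then have "range f \<subseteq> f ` ?I" by blast
    then have I: "infinite ?I" using False finite_subset finite_imageI by blast
    define s where "s = enumerate ?I"
    have s: "strict_mono s" "\<And>k. s k \<in> ?I"
      unfolding s_def using strict_mono_enumerate[OF I] enumerate_in_set[OF I] by auto
    have "inj (\<lambda>k. f (s k))"
    proof (rule linorder_injI)
      fix i j :: nat assume "i < j"
      then have "s i < s j" using s(1) by (simp add: strict_monoD)
      then show "f (s i) \<noteq> f (s j)" using s(2)[of j] by simp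
    qed
    moreover have "range (\<lambda>k. f (s k)) \<subseteq> (\<lambda>g. restrict g U) ` G"
      using assms(2) by (auto simp: f_def)
    ultimately have "\<exists>r h. strict_mono r \<and>
        (\<forall>K. compact K \<and> K \<subseteq> U \<longrightarrow> uniform_limit K (\<lambda>k. f (s (r k))) h sequentially)"
      by (intro assms(1)[unfolded normal_family_on_def, THEN spec[of _ "\<lambda>k. f (s k)"], THEN mp] conjI)
    then obtain r h where r: "strict_mono (r :: nat \<Rightarrow> nat)"
      "\<And>K. compact K \<Longrightarrow> K \<subseteq> U \<Longrightarrow> uniform_limit K (\<lambda>k. f (s (r k))) h sequentially"
      by blast
    have "uniform_limit K (\<lambda>k. g ((s \<circ> r) k)) h sequentially" if "compact K" "K \<subseteq> U" for K
    proof -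
      have eq: "f (s (r k)) x = g ((s \<circ> r) k) x" if "x \<in> K" for k x
        using f \<open>K \<subseteq> U\<close> that by auto
      show ?thesis using r(2)[OF that] by (simp add: uniform_limit_iff eq)
    qed
    then show ?thesis using that[OF strict_mono_o[OF s(1) r(1)]] by blast
  qed
qed

lemma uniform_limit_moving_point:
  assumes lim: "uniform_limit K f h F" and h: "continuous_on K h"
    and y: "(y \<longlongrightarrow> z) F" "z \<in> K" "\<forall>\<^sub>F k in F. y k \<in> K"
  shows "((\<lambda>k. f k (y k)) \<longlongrightarrow> h z) F"
proof (rule tendstoI)
  fix e :: real assume e: "e > 0"
  have "((\<lambda>k. h (y k)) \<longlongrightarrow> h z) F"
    using continuous_on_tendsto_compose[OF h y] .
  then have "\<forall>\<^sub>F k in F. dist (h (y k)) (h z) < e / 2" by (rule tendstoD) (use e in simp)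
  moreover have "\<forall>\<^sub>F k in F. \<forall>x\<in>K. dist (f k x) (h x) < e / 2"
    by (rule uniform_limitD[OF lim]) (use e in simp)
  ultimately show "\<forall>\<^sub>F k in F. dist (f k (y k)) (h z) < e"
    using y(3)
  proof eventually_elim
    case (elim k)
    then have "dist (f k (y k)) (h (y k)) < e / 2" by blast
    then show ?case using elim(1) dist_triangle[of "f k (y k)" "h z" "h (y k)"] by simp
  qed
qed

lemma continuous_proj_act:
  fixes A :: "complex ^ ('a :: finite) ^ 'a"
  assumes "invertible A"
  shows "continuous_on S (proj_act A)"
proof (rule continuous_on_sequentiallyI)
  fix y :: "nat \<Rightarrow> 'a cproj" and z assume "y \<longlonglongrightarrow> z"
  obtain v where v: "v \<noteq> 0" "proj v = z" using rep_cproj_nonzero proj_rep_cproj by metis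
  obtain u where u: "\<And>k. u k \<noteq> 0" "\<And>k. proj (u k) = y k" "u \<longlonglongrightarrow> v"
    using lift_convergent_sequence[of y v] \<open>y \<longlonglongrightarrow> z\<close> v by blast
  have "(\<lambda>k. proj (A *v u k)) \<longlonglongrightarrow> proj (A *v v)"
    using tendsto_matrix_vector_mult[OF tendsto_const u(3)]
    by (rule tendsto_proj) (use u v invertible_mult_nonzero[OF assms] in auto)
  then show "(\<lambda>k. proj_act A (y k)) \<longlonglongrightarrow> proj_act A z"
    using proj_act_proj[OF assms u(1)] proj_act_proj[OF assms v(1)] u(2) v(2) by simp
qed

text \<open>
  If \<open>G\<close> is normal on \<open>U\<close>, then precomposing with \<open>g\<close> transports any sequence of restrictions to the
  image of \<open>U\<close> into a sequence of restrictions to \<open>U\<close>, and a limit there is transported back by the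
  inverse \<open>g'\<close>.
\<close>

lemma equicontinuity_region_image_subset:
  fixes g :: "'a :: metric_space \<Rightarrow> 'a"
  assumes G: "\<And>h. h \<in> G \<Longrightarrow> h \<circ> g \<in> G"
    and g: "continuous_on UNIV g'" "g' \<circ> g = id" "g \<circ> g' = id"
  shows "g ` equicontinuity_region G \<subseteq> equicontinuity_region G"
proof (rule image_subsetI)
  have g'g: "g' (g x) = x" "g (g' x) = x" for x
    using g(2,3) by (metis comp_apply id_apply)+
  fix z assume "z \<in> equicontinuity_region G"
  then obtain U where U: "open U" "z \<in> U" "normal_family_on U ((\<lambda>g. restrict g U) ` G)"
    by (auto simp: equicontinuity_region_def)
  define V where "V = g' -` U"
  have V: "open V" "g z \<in> V"
    using open_vimage[OF U(1) g(1)] U(2) by (simp_all add: V_def g'g)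
  have "normal_family_on V ((\<lambda>g. restrict g V) ` G)"
    unfolding normal_family_on_def
  proof (intro allI impI, elim conjE)
    fix f :: "nat \<Rightarrow> 'a \<Rightarrow> 'a"
    assume f: "range f \<subseteq> (\<lambda>g. restrict g V) ` G" "inj f"
    have "\<forall>k. \<exists>h. h \<in> G \<and> f k = restrict h V" using f(1) by blast
    from choice[OF this] obtain h where h: "\<And>k. h k \<in> G" "\<And>k. f k = restrict (h k) V" by blast
    have range: "range (\<lambda>k. h k \<circ> g) \<subseteq> G" using G h(1) by blast
    obtain r l where r: "strict_mono (r :: nat \<Rightarrow> nat)"
      "\<forall>K. compact K \<and> K \<subseteq> U \<longrightarrow> uniform_limit K (\<lambda>k. h (r k) \<circ> g) l sequentially"
      by (rule normal_family_subsequence[OF U(3) range])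
    have "uniform_limit K (\<lambda>k. f (r k)) (l \<circ> g') sequentially" if K: "compact K" "K \<subseteq> V" for K
    proof -
      have "compact (g' ` K)"
        by (rule compact_continuous_image[OF continuous_on_subset[OF g(1)] K(1)]) simp
      moreover have "g' ` K \<subseteq> U" using K(2) by (auto simp: V_def)
      ultimately have "uniform_limit (g' ` K) (\<lambda>k. h (r k) \<circ> g) l sequentially" using r(2) by blast
      moreover have "f (r k) x = h (r k) x" if "x \<in> K" for k x using h(2) K(2) that by auto
      ultimately show ?thesis by (simp add: uniform_limit_iff g'g)
    qed
    then show "\<exists>r h. strict_mono r \<and>
        (\<forall>K. compact K \<and> K \<subseteq> V \<longrightarrow> uniform_limit K (\<lambda>k. f (r k)) h sequentially)"
      using r(1) by blast
  qed
  then show "g z \<in> equicontinuity_region G"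
    using V by (auto simp: equicontinuity_region_def)
qed

section \<open>The equicontinuity region\<close>

text \<open>
  A limit map \<open>h\<close> on a neighborhood of \<open>z\<close> satisfies \<open>h z = [w]\<close> by continuity. The hyperplane
  \<open>Q\<close> polar to the center \<open>[x]\<close> of the ball misses \<open>[w]\<close>. Its preimage under the \<open>k\<close>-th map is polar to
  \<open>q k\<close>, a rescaling of the adjoint applied to \<open>x\<close>, and \<open>q k\<close> tends to a multiple of \<open>w'\<close>. Hence \<open>z\<close> is a
  limit of points of these preimages, and \<open>[w] = h z\<close> would lie in the closed set \<open>Q\<close>.
\<close>

lemma degenerating_sequence_not_normal:
  assumes A: "degenerates_in G A w w'" and z: "z \<in> tangent_hyperplane (proj w')"
  shows "z \<notin> equicontinuity_region G"
proof
  assume "z \<in> equicontinuity_region G"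
  then obtain U where U: "open U" "z \<in> U" "normal_family_on U ((\<lambda>g. restrict g U) ` G)"
    by (auto simp: equicontinuity_region_def)
  obtain e where e: "e > 0" "cball z e \<subseteq> U" using U open_contains_cball by blast
  define K where "K = cball z e"
  have K: "compact K" "K \<subseteq> U" "z \<in> K"
    using e by (simp_all add: K_def closed_imp_compact_cproj)
  have nhd: "\<forall>\<^sub>F k in F. y k \<in> K" if "(y \<longlongrightarrow> z) F" for y :: "nat \<Rightarrow> _" and F
    using tendstoD[OF that e(1)] by eventually_elim (simp add: K_def dist_commute)
  have range: "range (\<lambda>k. proj_act (A k)) \<subseteq> G" using A by (auto simp: degenerates_in_def)
  obtain r h where r: "strict_mono (r :: nat \<Rightarrow> nat)"
    "uniform_limit K (\<lambda>k. proj_act (A (r k))) h sequentially"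
    by (rule normal_family_subsequence[OF U(3) range]) (use K in blast)
  define B where "B = (\<lambda>k. A (r k))"
  have lim: "uniform_limit K (\<lambda>k. proj_act (B k)) h sequentially" using r(2) by (simp add: B_def)
  have B: "degenerates B w w'"
    using A degenerates_subseq[OF _ r(1), of A] by (simp add: B_def degenerates_in_def)
  then have inv: "\<And>k. invertible (B k)" and w: "w \<noteq> 0" "herm w w = 0" "w' \<noteq> 0" "herm w' w' = 0"
    by (auto simp: degenerates_def U1_invertible)
  have cont: "continuous_on K h"
    by (rule uniform_limit_theorem[OF _ lim]) (simp_all add: continuous_proj_act[OF inv])
  obtain v where v: "v \<noteq> 0" "proj v = z" using rep_cproj_nonzero proj_rep_cproj by metis
  have vw: "herm v w' = 0" using z v proj_mem_tangent_hyperplane[OF w(3) v(1)] by simp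
  define x where "x = (axis None 1 :: complex ^ 'a option)"
  have xw: "herm x w' \<noteq> 0" "herm x w \<noteq> 0"
    unfolding x_def using negative_null_not_orthogonal[OF origin_negative] w by blast+
  \<comment> \<open>The limit map takes the value \<open>proj w\<close> off the hyperplane, hence also at \<open>z\<close>.\<close>
  have "h z = proj w"
  proof -
    define u where "u j = v + complex_of_real (1 / Suc j) *s x" for j
    have uw: "herm (u j) w' \<noteq> 0" for j
      using xw(1) by (simp add: u_def herm_add_left herm_smult_left vw del: of_nat_Suc)
    then have u0: "u j \<noteq> 0" for j by (metis herm_smult_left mult_zero_left vector_smult_lzero)
    have "(\<lambda>j. u j $ i) \<longlonglongrightarrow> v $ i" for i
    proof -
      have "(\<lambda>j. v $ i + complex_of_real (inverse (real (Suc j))) * x $ i)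
          \<longlonglongrightarrow> v $ i + complex_of_real 0 * x $ i"
        by (intro tendsto_intros LIMSEQ_inverse_real_of_nat)
      then show ?thesis by (simp add: u_def inverse_eq_divide del: of_nat_Suc)
    qed
    then have "u \<longlonglongrightarrow> v" by (rule vec_tendstoI)
    then have y: "(\<lambda>j. proj (u j)) \<longlonglongrightarrow> z"
      using tendsto_proj[of u v] u0 v by simp
    have val: "h (proj (u j)) = proj w" if "proj (u j) \<in> K" for j
    proof -
      have "proj (u j) \<notin> tangent_hyperplane (proj w')"
        using uw u0 w proj_mem_tangent_hyperplane by blast
      then have "(\<lambda>k. proj_act (B k) (proj (u j))) \<longlonglongrightarrow> proj w"
        using degenerates_tendsto[OF B tendsto_const] by blast
      then show ?thesis using tendsto_uniform_limitI[OF lim that] LIMSEQ_unique by blast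
    qed
    have "(\<lambda>j. h (proj (u j))) \<longlonglongrightarrow> h z"
      using continuous_on_tendsto_compose[OF cont y K(3) nhd[OF y]] .
    moreover have "(\<lambda>j. h (proj (u j))) \<longlonglongrightarrow> proj w"
      by (rule tendsto_eventually) (use nhd[OF y] in eventually_elim, simp add: val)
    ultimately show ?thesis using LIMSEQ_unique by blast
  qed
  obtain t where t: "\<And>k. t k > 0" "(\<lambda>k. t k *\<^sub>R herm_adjoint (B k)) \<longlonglongrightarrow> rank_one w' w"
    using degenerates_adjoint[OF B] by (auto simp: degenerates_def)
  define q where "q k = (t k *\<^sub>R herm_adjoint (B k)) *v x" for k
  have q: "q \<longlonglongrightarrow> herm x w *s w'"
    unfolding q_def rank_one_mult[symmetric] by (intro tendsto_intros t(2))
  \<comment> \<open>The correction along \<open>x\<close> puts \<open>u k\<close> on the hyperplane polar to \<open>q k\<close>; its coefficient tends to 0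
    because \<open>herm v w' = 0\<close>, while \<open>x\<close> stays off these hyperplanes.\<close>
  define u where "u k = v - (herm v (q k) / herm x (q k)) *s x" for k
  have xq: "(\<lambda>k. herm x (q k)) \<longlonglongrightarrow> herm x (herm x w *s w')"
    by (intro tendsto_intros q)
  have xq0: "herm x (herm x w *s w') \<noteq> 0" using xw by (simp add: herm_smult_right)
  have "(\<lambda>k. herm v (q k) / herm x (q k)) \<longlonglongrightarrow> herm v (herm x w *s w') / herm x (herm x w *s w')"
    by (intro tendsto_intros q xq0)
  then have c: "(\<lambda>k. herm v (q k) / herm x (q k)) \<longlonglongrightarrow> 0" by (simp add: herm_smult_right vw)
  have "(\<lambda>k. u k $ i) \<longlonglongrightarrow> v $ i" for i
    using tendsto_diff[OF tendsto_const[of "v $ i"] tendsto_mult[OF c tendsto_const[of "x $ i"]]]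
    by (simp add: u_def)
  then have u: "u \<longlonglongrightarrow> v" by (rule vec_tendstoI)
  have u0: "\<forall>\<^sub>F k in sequentially. u k \<noteq> 0" using tendsto_imp_eventually_ne[OF u v(1)] .
  have y: "(\<lambda>k. proj (u k)) \<longlonglongrightarrow> z" using tendsto_proj[OF u v(1) u0] v by simp
  have "(\<lambda>k. proj_act (B k) (proj (u k))) \<longlonglongrightarrow> proj w"
    using uniform_limit_moving_point[OF lim cont y K(3) nhd[OF y]] \<open>h z = proj w\<close> by simp
  moreover have "closed (tangent_hyperplane (proj x))"
    using closed_UN_tangent_hyperplane[of "{proj x}"] by simp
  moreover have x0: "x \<noteq> 0" by (simp add: x_def)
  have "\<forall>\<^sub>F k in sequentially. proj_act (B k) (proj (u k)) \<in> tangent_hyperplane (proj x)"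
    using u0 tendsto_imp_eventually_ne[OF xq xq0]
  proof eventually_elim
    case (elim k)
    have "complex_of_real (t k) * herm (B k *v u k) x = herm (u k) (q k)"
      by (simp add: q_def scaleR_matrix_vector scaleR_eq_smult herm_smult_right herm_adjoint)
    also have "\<dots> = 0" using elim(2) by (simp add: u_def herm_diff_left herm_smult_left)
    finally have "herm (B k *v u k) x = 0" using t(1)[of k] by simp
    then show ?case
      using proj_act_proj[OF inv elim(1)] invertible_mult_nonzero[OF inv elim(1)] x0
      by (simp add: proj_mem_tangent_hyperplane)
  qed
  ultimately have "proj w \<in> tangent_hyperplane (proj x)"
    using Lim_in_closed_set[of "tangent_hyperplane (proj x)" _ sequentially] by simp
  then have "herm w x = 0" using proj_mem_tangent_hyperplane x0 w by blast
  then show False using xw(2) herm_commute[of x w] by simp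
qed

lemma normal_family_off_tangent_hyperplanes:
  assumes G: "discrete_subgroup G"
  defines "\<Omega> \<equiv> - (\<Union>p\<in>chen_greenberg_limit_set G. tangent_hyperplane p)"
  shows "normal_family_on \<Omega> ((\<lambda>g. restrict g \<Omega>) ` G)"
  unfolding normal_family_on_def
proof (intro allI impI, elim conjE)
  fix f :: "nat \<Rightarrow> 'a option cproj \<Rightarrow> 'a option cproj"
  assume f: "range f \<subseteq> (\<lambda>g. restrict g \<Omega>) ` G" "inj f"
  have "\<forall>k. \<exists>h. h \<in> G \<and> f k = restrict h \<Omega>" using f(1) by blast
  from choice[OF this] obtain g where g: "\<And>k. g k \<in> G" "\<And>k. f k = restrict (g k) \<Omega>" by blast
  have g': "inj g" "range g \<subseteq> G" using f(2) g by (metis injD injI, blast)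
  obtain r A w w' where r: "strict_mono (r :: nat \<Rightarrow> nat)" "degenerates_in G A w w'"
    "\<forall>k. proj_act (A k) = g (r k)"
    by (rule discrete_subgroup_degenerating_subsequence[OF G g'])
  have "proj w' \<in> chen_greenberg_limit_set G"
    using degenerates_in_limit_set[OF degenerates_in_adjoint[OF G r(2)]] .
  then have "K \<inter> tangent_hyperplane (proj w') = {}" if "K \<subseteq> \<Omega>" for K
    using that by (auto simp: \<Omega>_def)
  then have lim: "uniform_limit K (\<lambda>k. g (r k)) (\<lambda>_. proj w) sequentially"
    if "compact K" "K \<subseteq> \<Omega>" for K
    using degenerates_uniform_limit[of A w w' K] r that by (simp add: degenerates_in_def)
  have "uniform_limit K (\<lambda>k. f (r k)) (\<lambda>_. proj w) sequentially" if K: "compact K" "K \<subseteq> \<Omega>" for K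
  proof -
    have "f (r k) x = g (r k) x" if "x \<in> K" for k x using g(2) K(2) that by auto
    then show ?thesis using lim[OF K] by (simp add: uniform_limit_iff)
  qed
  then show "\<exists>r h. strict_mono r \<and>
      (\<forall>K. compact K \<and> K \<subseteq> \<Omega> \<longrightarrow> uniform_limit K (\<lambda>k. f (r k)) h sequentially)"
    using r(1) by blast
qed

text \<open>
  A limit point is attracting for some degenerating sequence, hence repelling for the sequence of
  inverses, which is the one that fails to be normal.
\<close>

lemma equicontinuity_region_eq:
  assumes G: "discrete_subgroup G"
  shows "equicontinuity_region G = - (\<Union>p\<in>chen_greenberg_limit_set G. tangent_hyperplane p)"
proof (intro equalityI subsetI)
  fix z assume "z \<in> - (\<Union>p\<in>chen_greenberg_limit_set G. tangent_hyperplane p)"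
  moreover have "open (- (\<Union>p\<in>chen_greenberg_limit_set G. tangent_hyperplane p))"
    using closed_UN_tangent_hyperplane[OF closed_limit_set[OF G]] by (rule open_Compl)
  ultimately show "z \<in> equicontinuity_region G"
    unfolding equicontinuity_region_def using normal_family_off_tangent_hyperplanes[OF G] by blast
next
  fix z assume z: "z \<in> equicontinuity_region G"
  have "z \<notin> tangent_hyperplane p" if p: "p \<in> chen_greenberg_limit_set G" for p
  proof -
    obtain A w w' where A: "degenerates_in G A w w'" "p = proj w"
      using limit_set_attractor[OF G p] .
    then show ?thesis
      using degenerating_sequence_not_normal[OF degenerates_in_adjoint[OF G A(1)]] z by blast
  qed
  then show "z \<in> - (\<Union>p\<in>chen_greenberg_limit_set G. tangent_hyperplane p)" by blast
qed

lemma equicontinuity_region_invariant: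
  assumes G: "discrete_subgroup G" and g: "g \<in> G"
  shows "g ` equicontinuity_region G = equicontinuity_region G"
proof -
  obtain A where A: "A \<in> U1" "g = proj_act A" using discrete_subgroup_PU1[OF G g] by blast
  define g' where "g' = proj_act (herm_adjoint A)"
  have g': "g' \<in> G" "g' \<circ> g = id" "g \<circ> g' = id" "continuous_on UNIV g" "continuous_on UNIV g'"
    unfolding g'_def A(2)
    using discrete_subgroup_adjoint[OF G] proj_act_adjoint A g continuous_proj_act U1_invertible
      U1_adjoint_inverse(3)
    by blast+
  have 1: "g ` equicontinuity_region G \<subseteq> equicontinuity_region G"
    by (rule equicontinuity_region_image_subset[of G g g'])
      (use g' discrete_subgroup_comp[OF G _ g] in auto)
  have 2: "g' ` equicontinuity_region G \<subseteq> equicontinuity_region G"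
    by (rule equicontinuity_region_image_subset[of G g' g])
      (use g' discrete_subgroup_comp[OF G _ g'(1)] in auto)
  have "equicontinuity_region G = g ` (g' ` equicontinuity_region G)"
    by (simp add: image_comp g'(3))
  then show ?thesis using 1 2 by blast
qed

lemma orbit_accumulation_points_subset_limit_set:
  assumes G: "discrete_subgroup G" and K: "compact K" "K \<subseteq> equicontinuity_region G"
  shows "orbit_accumulation_points G K \<subseteq> chen_greenberg_limit_set G"
proof
  fix z assume z: "z \<in> orbit_accumulation_points G K"
  have "K \<inter> tangent_hyperplane p = {}" if "p \<in> chen_greenberg_limit_set G" for p
    using K(2) that unfolding equicontinuity_region_eq[OF G] by blast
  then obtain A w w' where "degenerates_in G A w w'" "z = proj w"
    using orbit_accumulation_point_is_attractor[OF G K(1) _ z] by metis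
  then show "z \<in> chen_greenberg_limit_set G" using degenerates_in_limit_set by blast
qed

text \<open>
  A point of the equicontinuity region is no limit point, because a limit point lies on its own tangent
  hyperplane. So the orbit of a compact neighborhood does not accumulate at it, and a smaller
  neighborhood meets only finitely many of its translates.
\<close>

lemma acts_discontinuously_on_equicontinuity_region:
  fixes G :: "(('n :: finite) option cproj \<Rightarrow> 'n option cproj) set"
  assumes G: "discrete_subgroup G"
  shows "acts_discontinuously_on G (equicontinuity_region G)"
  unfolding acts_discontinuously_on_def
proof (intro conjI ballI)
  show op: "open (equicontinuity_region G)"
    unfolding equicontinuity_region_eq[OF G]
    using closed_UN_tangent_hyperplane[OF closed_limit_set[OF G]] by (rule open_Compl)
  show "g ` equicontinuity_region G = equicontinuity_region G" if "g \<in> G" for g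
    using equicontinuity_region_invariant[OF G that] .
  fix z assume z: "z \<in> equicontinuity_region G"
  obtain e where e: "e > 0" "cball z e \<subseteq> equicontinuity_region G"
    using op z open_contains_cball by blast
  have "z \<notin> chen_greenberg_limit_set G"
    using z limit_set_point_in_own_tangent_hyperplane[OF G] unfolding equicontinuity_region_eq[OF G]
    by blast
  then have "z \<notin> orbit_accumulation_points G (cball z e)"
    using orbit_accumulation_points_subset_limit_set[OF G _ e(2)] closed_imp_compact_cproj by blast
  then obtain V where V: "open V" "z \<in> V" "finite {g \<in> G. g ` cball z e \<inter> V \<noteq> {}}"
    unfolding orbit_accumulation_points_def by blast
  have "finite {g \<in> G. g ` (ball z e \<inter> V) \<inter> (ball z e \<inter> V) \<noteq> {}}"
    by (rule finite_subset[OF _ V(3)]) (use ball_subset_cball in blast)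
  moreover have "ball z e \<inter> V \<subseteq> equicontinuity_region G" using e(2) ball_subset_cball by blast
  ultimately show "\<exists>U. open U \<and> z \<in> U \<and> U \<subseteq> equicontinuity_region G \<and>
      finite {g \<in> G. g ` U \<inter> U \<noteq> {}}"
    using V e(1) by (intro exI[of _ "ball z e \<inter> V"]) auto
qed

theorem theorem1:
  fixes G :: "(('n :: finite) option cproj \<Rightarrow> 'n option cproj) set"
  assumes "discrete_subgroup G"
  shows "- equicontinuity_region G = (\<Union>p\<in>chen_greenberg_limit_set G. tangent_hyperplane p) \<and>
         acts_discontinuously_on G (equicontinuity_region G) \<and>
         (\<forall>K. compact K \<and> K \<subseteq> equicontinuity_region G \<longrightarrow>
            orbit_accumulation_points G K \<subseteq> chen_greenberg_limit_set G)"
  using equicontinuity_region_eq[OF assms] acts_discontinuously_on_equicontinuity_region[OF assms]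
    orbit_accumulation_points_subset_limit_set[OF assms] by simp

end
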